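(* Let $S$ be the set of all infinite sequences $s=(s_1,s_2,\ldots)$ of positive integers, let $X=\bigvee_{s\in S}\mathbb{R}_s$ be the wedge at $0$ of copies $\mathbb{R}_s=\mathbb{R}$ of the real line indexed over $S$ (with the quotient diffeology from $\coprod_{s\in S}\mathbb{R}_s$), and let $V=F(X)$ be the free diffeological vector space generated by $X$. For the diffeological vector space $V$ (which is both free and projective), $D(V)$ is not a topological vector space.
   Context: All vector spaces are over $\mathbb{R}$. A diffeological space is a set $X$ with a collection of maps $U\to X$ (called plots), where $U$ ranges over open subsets of $\mathbb{R}^n$, $n\in\mathbb{N}$ arbitrary, such that: every constant map is a plot; the precomposition of a plot $U\to X$ with a smooth map $V\to U$ between open subsets of Euclidean spaces is a plot; a map $U\to X$ that restricts to a plot on each member of some open cover of $U$ is a plot. A map between diffeological spaces is smooth if its composite with every plot of the source is a plot of the target. Smooth manifolds carry the diffeology of all smooth maps from open subsets of Euclidean spaces. A map into a product is a plot iff its components are plots. A map $p:U\to\coprod_i X_i$ is a plot iff locally it is a plot of one of the $X_i$. For a surjection $\pi:Y\to X$ from a diffeological space $Y$ to a set $X$, the quotient diffeology on $X$ has as plots the maps which locally lift along $\pi$ to plots of $Y$. The wedge at $0$ of copies of $\mathbb{R}$ is the quotient of their coproduct obtained by identifying all the origins, with the quotient diffeology. The $D$-topology on a diffeological space $X$ is the finest topology for which all plots are continuous ($A\subseteq X$ is open iff $p^{-1}(A)$ is open for every plot $p$); $D(X)$ denotes $X$ with this topology. A diffeological vector space is a vector space with a diffeology such that addition and scalar multiplication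 are smooth. The free diffeological vector space $F(X)$ on a diffeological space $X$ is the vector space $\bigoplus_{x\in X}\mathbb{R}$ with basis $\{[x]:x\in X\}$, whose plots are the maps locally of the form $u\mapsto\sum_{i=1}^n r_i(u)[q_i(u)]$ with $n\geq 0$, $r_i$ smooth real functions and $q_i$ plots of $X$. A linear subduction is a linear surjection $V\to W$ of diffeological vector spaces such that $W$ has the quotient diffeology. A diffeological vector space $P$ is projective if for every linear subduction $V\to W$ and every smooth linear map $P\to W$ there is a smooth linear map $P\to V$ lifting it. A topological vector space is a vector space with a topology for which addition (from the product topology) and scalar multiplication are continuous. *)

theory Defs
  imports "HOL-Analysis.Analysis" "HOL-Library.Poly_Mapping"
begin

text \<open>
  The dimension of the domain of a plot varies, so R^n is taken to be the space
  \<^term>\<open>Euclidean_space n\<close> of sequences vanishing from index \<open>n\<close> on.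
  A function is of class C^(k+1) if it is continuous and has partial
  derivatives of class C^k. When \<open>x\<close> lies in an open \<open>U\<close> of R^n and \<open>i < n\<close>, the points
  \<open>x(i := t)\<close> lie in \<open>U\<close> for \<open>t\<close> near \<open>x i\<close>, so only the values on \<open>U\<close> matter.
\<close>

primrec C_k_on :: "nat \<Rightarrow> nat \<Rightarrow> (nat \<Rightarrow> real) set \<Rightarrow> ((nat \<Rightarrow> real) \<Rightarrow> real) \<Rightarrow> bool" where
  "C_k_on 0 n U f \<longleftrightarrow> continuous_map (subtopology (Euclidean_space n) U) euclideanreal f"
| "C_k_on (Suc k) n U f \<longleftrightarrow>
     continuous_map (subtopology (Euclidean_space n) U) euclideanreal f \<and>
     (\<forall>i<n. \<exists>g. C_k_on k n U g \<and>
        (\<forall>x\<in>U. ((\<lambda>t. f (x(i := t))) has_real_derivative g x) (at (x i))))"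

definition smooth_real_on :: "nat \<Rightarrow> (nat \<Rightarrow> real) set \<Rightarrow> ((nat \<Rightarrow> real) \<Rightarrow> real) \<Rightarrow> bool" where
  "smooth_real_on n U f \<longleftrightarrow> openin (Euclidean_space n) U \<and> (\<forall>k. C_k_on k n U f)"

definition smooth_euclidean ::
  "nat \<Rightarrow> (nat \<Rightarrow> real) set \<Rightarrow> nat \<Rightarrow> (nat \<Rightarrow> real) set \<Rightarrow> ((nat \<Rightarrow> real) \<Rightarrow> nat \<Rightarrow> real) \<Rightarrow> bool" where
  "smooth_euclidean m V n U f \<longleftrightarrow>
     openin (Euclidean_space m) V \<and> openin (Euclidean_space n) U \<and>
     f ` V \<subseteq> U \<and> (\<forall>i<n. smooth_real_on m V (\<lambda>x. f x i))"

definition locally_on :: "nat \<Rightarrow> (nat \<Rightarrow> real) set \<Rightarrow> ((nat \<Rightarrow> real) set \<Rightarrow> bool) \<Rightarrow> bool" where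
  "locally_on n U P \<longleftrightarrow>
     openin (Euclidean_space n) U \<and>
     (\<forall>u\<in>U. \<exists>V. openin (Euclidean_space n) V \<and> u \<in> V \<and> V \<subseteq> U \<and> P V)"

text \<open>
  A diffeology on the type \<open>'a\<close> is given by its plots: \<open>D n U p\<close> means that the restriction of
  \<open>p\<close> to the open subset \<open>U\<close> of R^n is a plot. As \<open>p\<close> is a total function, one must
  require that its values outside \<open>U\<close> are irrelevant.
\<close>

type_synonym 'a diffeology = "nat \<Rightarrow> (nat \<Rightarrow> real) set \<Rightarrow> ((nat \<Rightarrow> real) \<Rightarrow> 'a) \<Rightarrow> bool"

definition is_diffeology :: "'a diffeology \<Rightarrow> bool" where
  "is_diffeology D \<longleftrightarrow>
     (\<forall>n U p. D n U p \<longrightarrow> openin (Euclidean_space n) U) \<and>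
     (\<forall>n U p q. D n U p \<longrightarrow> (\<forall>u\<in>U. p u = q u) \<longrightarrow> D n U q) \<and>
     (\<forall>n U a. openin (Euclidean_space n) U \<longrightarrow> D n U (\<lambda>_. a)) \<and>
     (\<forall>m V n U f p. smooth_euclidean m V n U f \<longrightarrow> D n U p \<longrightarrow> D m V (p \<circ> f)) \<and>
     (\<forall>n U p. locally_on n U (\<lambda>V. D n V p) \<longrightarrow> D n U p)"

definition smooth_map :: "'a diffeology \<Rightarrow> 'b diffeology \<Rightarrow> ('a \<Rightarrow> 'b) \<Rightarrow> bool" where
  "smooth_map D E f \<longleftrightarrow> (\<forall>n U p. D n U p \<longrightarrow> E n U (f \<circ> p))"

definition real_diffeology :: "real diffeology" where
  "real_diffeology = smooth_real_on"

definition prod_diffeology :: "'a diffeology \<Rightarrow> 'b diffeology \<Rightarrow> ('a \<times> 'b) diffeology" where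
  "prod_diffeology D E n U p \<longleftrightarrow> D n U (fst \<circ> p) \<and> E n U (snd \<circ> p)"

definition coprod_diffeology :: "('i \<Rightarrow> 'a diffeology) \<Rightarrow> ('i \<times> 'a) diffeology" where
  "coprod_diffeology D n U p \<longleftrightarrow>
     locally_on n U (\<lambda>V. \<exists>i q. D i n V q \<and> (\<forall>v\<in>V. p v = (i, q v)))"

definition quotient_diffeology :: "('a \<Rightarrow> 'b) \<Rightarrow> 'a diffeology \<Rightarrow> 'b diffeology" where
  "quotient_diffeology \<pi> D n U p \<longleftrightarrow>
     locally_on n U (\<lambda>V. \<exists>q. D n V q \<and> (\<forall>v\<in>V. p v = \<pi> (q v)))"

definition D_topology :: "'a diffeology \<Rightarrow> 'a topology" where
  "D_topology D =
     topology (\<lambda>A. \<forall>n U p. D n U p \<longrightarrow> openin (Euclidean_space n) {u \<in> U. p u \<in> A})"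

definition wedge_rel :: "'i \<times> real \<Rightarrow> 'i \<times> real \<Rightarrow> bool" where
  "wedge_rel a b \<longleftrightarrow> a = b \<or> snd a = 0 \<and> snd b = 0"

quotient_type 'i wedge = "'i \<times> real" / wedge_rel
  by (auto intro!: equivpI reflpI sympI transpI simp: wedge_rel_def)

definition wedge_diffeology :: "'i wedge diffeology" where
  "wedge_diffeology = quotient_diffeology abs_wedge (coprod_diffeology (\<lambda>_. real_diffeology))"

text \<open>Sequences are indexed from 0 here.\<close>

typedef pos_seq = "{s :: nat \<Rightarrow> nat. \<forall>i. 0 < s i}"
  by (rule exI[of _ "\<lambda>_. 1"]) simp

definition diffeological_vector_space :: "'v::real_vector diffeology \<Rightarrow> bool" where
  "diffeological_vector_space D \<longleftrightarrow>
     is_diffeology D \<and>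
     smooth_map (prod_diffeology D D) D (\<lambda>(x, y). x + y) \<and>
     smooth_map (prod_diffeology real_diffeology D) D (\<lambda>(r, x). r *\<^sub>R x)"

definition linear_subduction ::
  "'v::real_vector diffeology \<Rightarrow> 'w::real_vector diffeology \<Rightarrow> ('v \<Rightarrow> 'w) \<Rightarrow> bool" where
  "linear_subduction D E \<pi> \<longleftrightarrow> linear \<pi> \<and> surj \<pi> \<and> E = quotient_diffeology \<pi> D"

text \<open>
  HOL cannot quantify over types inside a formula: the lifting property is stated against all
  diffeological vector spaces on two given types. Projectivity is the validity of
  this predicate for all \<open>'v\<close> and \<open>'w\<close>, that is, with both left as free type variables in a theorem.
\<close>

definition projective_against ::
  "'v::real_vector itself \<Rightarrow> 'w::real_vector itself \<Rightarrow> 'p::real_vector diffeology \<Rightarrow> bool" where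
  "projective_against _ _ P \<longleftrightarrow>
     diffeological_vector_space P \<and>
     (\<forall>(D :: 'v diffeology) (E :: 'w diffeology) \<pi> f.
        diffeological_vector_space D \<longrightarrow> diffeological_vector_space E \<longrightarrow>
        linear_subduction D E \<pi> \<longrightarrow> linear f \<longrightarrow> smooth_map P E f \<longrightarrow>
        (\<exists>g. linear g \<and> smooth_map P D g \<and> \<pi> \<circ> g = f))"

text \<open>
  The vector space with basis \<open>'x\<close> is the type \<open>'x \<Rightarrow>\<^sub>0 real\<close> of finitely supported functions, with
  \<open>[x]\<close> being \<open>Poly_Mapping.single x 1\<close>.
\<close>

instantiation poly_mapping :: (type, real_vector) real_vector
begin

lift_definition scaleR_poly_mapping :: "real \<Rightarrow> ('a \<Rightarrow>\<^sub>0 'b) \<Rightarrow> 'a \<Rightarrow>\<^sub>0 'b" is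
  "\<lambda>r f x. r *\<^sub>R f x"
  by (erule rev_finite_subset) auto

instance
  by standard
    (transfer, simp add: fun_eq_iff scaleR_add_right scaleR_add_left)+

end

definition free_diffeology :: "'x diffeology \<Rightarrow> ('x \<Rightarrow>\<^sub>0 real) diffeology" where
  "free_diffeology X n U p \<longleftrightarrow>
     locally_on n U (\<lambda>V. \<exists>k r q.
       (\<forall>i<k. smooth_real_on n V (r i) \<and> X n V (q i)) \<and>
       (\<forall>v\<in>V. p v = (\<Sum>i<k::nat. r i v *\<^sub>R Poly_Mapping.single (q i v) 1)))"

definition topological_vector_space :: "'v::real_vector topology \<Rightarrow> bool" where
  "topological_vector_space T \<longleftrightarrow>
     topspace T = UNIV \<and>
     continuous_map (prod_topology T T) T (\<lambda>(x, y). x + y) \<and>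
     continuous_map (prod_topology euclideanreal T) T (\<lambda>(r, x). r *\<^sub>R x)"

end

theory Submission
  imports Defs
begin

text \<open>
  Projectivity. A smooth linear map out of \<open>F(X)\<close> is a smooth map out of \<open>X\<close>, hence a family of plots
  defined on the real line that agree at \<open>0\<close>. Local lifts of such a plot along a linear subduction can
  be glued to a global one by smooth cutoff functions, and a translation by a constant makes the
  lifts of all arms agree at \<open>0\<close>.

  Failure of continuity of addition. Let \<open>c\<^sub>n\<close> be the constant sequence \<open>n + 1\<close>, put
  \<open>e(s, t) = [t]\<^sub>s - [0]\<close> and consider the set \<open>C\<close> of all \<open>e(c\<^sub>n, 1/s\<^sub>n) + e(s, 1/(n+1))\<close>. Locally a
  plot of \<open>F(X)\<close> meets finitely many arms, hence finitely many points of \<open>C\<close>; as points are closed,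
  \<open>C\<close> is closed, and it does not contain \<open>0\<close>. If \<open>B\<close>, \<open>B'\<close> are neighbourhoods of \<open>0\<close>, choose \<open>s\<close> with
  \<open>e(c\<^sub>n, 1/s\<^sub>n) \<in> B\<close> for all \<open>n\<close> and then \<open>n\<close> with \<open>e(s, 1/(n+1)) \<in> B'\<close>: so \<open>B + B'\<close> meets \<open>C\<close>.
\<close>

section \<open>Smooth functions on open subsets of Euclidean spaces\<close>

text \<open>Addition is smooth, hence continuous for the D-topology of V x V; it fails only because
  the product topology of D(V) x D(V) is coarser. A plot sees finitely many arms at a time, whereas
  a box B x B' constrains all arms at once, with no common radius. The radii of B along the
  countably many arms c_n are beaten by the reciprocals of some sequence s, and the wedge runs over
  all of S so that every such s is itself an arm, along which B' has some radius in turn. A point of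
  C carries its label (s, n) in its support, one arm for s and one for n, so finitely many arms
  leave finitely many labels. Points are closed because tent functions on the wedge extend to linear
  functionals that separate vectors and are continuous along plots. For projectivity the obstacle is
  that a quotient diffeology provides only local lifts. Lifts of one plot form an affine space, so
  they can be blended; the cutoff comes from exp(-1/x). As \<open>C_k_on\<close> speaks of partial
  derivatives only, closure under composition has to be derived from these.\<close>

lemma Euclidean_space_eq_top_of_set: "Euclidean_space n = top_of_set {x. \<forall>i\<ge>n. x i = 0}"
  by (simp add: Euclidean_space_def euclidean_product_topology)

lemma openin_Euclidean_space_subset:
  "openin (Euclidean_space n) U \<Longrightarrow> U \<subseteq> {x. \<forall>i\<ge>n. x i = 0}"
  using openin_subset topspace_Euclidean_space by blast

text \<open>A basic open set of the product topology has one factor per index, but from index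
  \<open>n\<close> on both \<open>x\<close> and \<open>y\<close> vanish. Only finitely many radii
  matter, and they have a positive minimum.\<close>

lemma openin_Euclidean_space_box:
  assumes "openin (Euclidean_space n) U" "x \<in> U"
  obtains e where "e > 0"
    "\<And>y. \<forall>i\<ge>n. y i = 0 \<Longrightarrow> \<forall>i<n. \<bar>y i - x i\<bar> < e \<Longrightarrow> y \<in> U"
proof -
  obtain T where T: "openin (powertop_real UNIV) T" "U = T \<inter> {x. \<forall>i\<ge>n. x i = 0}"
    using assms(1) unfolding Euclidean_space_def openin_subtopology by blast
  have "x \<in> T" using assms(2) T(2) by blast
  from product_topology_open_contains_basis[OF T(1) this] obtain X where
    X: "x \<in> (\<Pi>\<^sub>E i\<in>UNIV. X i)" "\<And>i. open (X i)" "(\<Pi>\<^sub>E i\<in>UNIV. X i) \<subseteq> T"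
    by (auto simp: open_openin[symmetric])
  have "\<exists>d>0. \<forall>y. \<bar>y - x i\<bar> < d \<longrightarrow> y \<in> X i" for i
    using X(1) X(2)[of i] by (auto simp: open_dist dist_real_def PiE_iff)
  then obtain d where d: "\<And>i. d i > 0" "\<And>i y. \<bar>y - x i\<bar> < d i \<Longrightarrow> y \<in> X i"
    by metis
  \<comment> \<open>The extra element 1 keeps the set nonempty when \<open>n\<close> is 0.\<close>
  define e where "e = Min (insert 1 (d ` {..<n}))"
  have "e > 0" "\<And>i. i < n \<Longrightarrow> e \<le> d i"
    using d(1) by (auto simp: e_def intro: Min_le)
  moreover have "y \<in> U" if y: "\<forall>i\<ge>n. y i = 0" "\<forall>i<n. \<bar>y i - x i\<bar> < e" for y
  proof -
    have "y i \<in> X i" for i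
    proof (cases "i < n")
      case True
      then show ?thesis using y(2) calculation(2)[of i] d(2) by fastforce
    next
      case False
      then have "y i = x i"
        using y(1) openin_Euclidean_space_subset[OF assms(1)] assms(2) by auto
      then show ?thesis using X(1) by (auto simp: PiE_iff)
    qed
    then have "y \<in> T" using X(3) by auto
    then show ?thesis using T(2) y(1) by auto
  qed
  ultimately show ?thesis using that by blast
qed

text \<open>This makes partial derivatives at points of \<open>U\<close> independent of the values
  of a function outside \<open>U\<close>.\<close>

lemma eventually_fun_upd_in_openin:
  assumes "openin (Euclidean_space n) U" "x \<in> U" "i < n"
  shows "\<forall>\<^sub>F t in nhds (x i). x(i := t) \<in> U"
proof -
  obtain e where e: "e > 0"
    "\<And>y. \<forall>i\<ge>n. y i = 0 \<Longrightarrow> \<forall>i<n. \<bar>y i - x i\<bar> < e \<Longrightarrow> y \<in> U"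
    using openin_Euclidean_space_box[OF assms(1,2)] by metis
  have "x(i := t) \<in> U" if "dist t (x i) < e" for t
    using e assms openin_Euclidean_space_subset[OF assms(1)] that
    by (intro e(2)) (auto simp: dist_real_def)
  then show ?thesis using e(1) by (auto simp: eventually_nhds_metric)
qed

section \<open>Locality and algebra of C^k functions\<close>

lemma continuous_map_Euclidean_subtopology_iff:
  assumes "openin (Euclidean_space n) U"
  shows "continuous_map (subtopology (Euclidean_space n) U) euclideanreal f \<longleftrightarrow> continuous_on U f"
proof -
  have "{x. \<forall>i\<ge>n. x i = 0} \<inter> U = U"
    using openin_Euclidean_space_subset[OF assms] by auto
  then show ?thesis
    by (simp add: Euclidean_space_eq_top_of_set subtopology_subtopology)
qed

lemma C_k_on_imp_continuous_on:
  assumes "openin (Euclidean_space n) U" "C_k_on k n U f"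
  shows "continuous_on U f"
  using assms by (cases k) (auto simp: continuous_map_Euclidean_subtopology_iff)

lemma C_k_on_Suc_iff:
  assumes "openin (Euclidean_space n) U"
  shows "C_k_on (Suc k) n U f \<longleftrightarrow> continuous_on U f \<and> (\<forall>i<n. \<exists>g. C_k_on k n U g \<and>
        (\<forall>x\<in>U. ((\<lambda>t. f (x(i := t))) has_real_derivative g x) (at (x i))))"
  using assms by (simp add: continuous_map_Euclidean_subtopology_iff)

lemma C_k_on_SucE:
  assumes "openin (Euclidean_space n) U" "C_k_on (Suc k) n U f"
  obtains g where "\<And>i. i < n \<Longrightarrow> C_k_on k n U (g i)"
    "\<And>i x. i < n \<Longrightarrow> x \<in> U \<Longrightarrow>
       ((\<lambda>t. f (x(i := t))) has_real_derivative g i x) (at (x i))"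
proof -
  have "\<forall>i\<in>{..<n}. \<exists>h. C_k_on k n U h \<and>
      (\<forall>x\<in>U. ((\<lambda>t. f (x(i := t))) has_real_derivative h x) (at (x i)))"
    using assms(2) unfolding C_k_on_Suc_iff[OF assms(1)] by blast
  from bchoice[OF this] obtain g where "\<forall>i\<in>{..<n}. C_k_on k n U (g i) \<and>
      (\<forall>x\<in>U. ((\<lambda>t. f (x(i := t))) has_real_derivative g i x) (at (x i)))" ..
  then show ?thesis by (intro that[of g]) auto
qed

lemma C_k_on_0_iff:
  assumes "openin (Euclidean_space n) U"
  shows "C_k_on 0 n U f \<longleftrightarrow> continuous_on U f"
  using assms by (simp add: continuous_map_Euclidean_subtopology_iff)

declare C_k_on.simps [simp del]

lemma C_k_on_cong:
  assumes U: "openin (Euclidean_space n) U" and eq: "\<And>x. x \<in> U \<Longrightarrow> f x = g x"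
    and f: "C_k_on k n U f"
  shows "C_k_on k n U g"
proof (cases k)
  case 0
  then show ?thesis using f continuous_on_cong[of U U f g] eq by (simp add: C_k_on_0_iff[OF U])
next
  case (Suc l)
  have "continuous_on U g"
    using C_k_on_imp_continuous_on[OF U f] continuous_on_cong[of U U f g] eq by simp
  moreover have *: "((\<lambda>t. g (x(i := t))) has_real_derivative d) (at (x i))"
    if "((\<lambda>t. f (x(i := t))) has_real_derivative d) (at (x i))" "x \<in> U" "i < n" for x i d
  proof -
    have "\<forall>\<^sub>F t in nhds (x i). f (x(i := t)) = g (x(i := t))"
      using eventually_fun_upd_in_openin[OF U that(2,3)] by eventually_elim (rule eq)
    then show ?thesis using that(1) by (simp only: DERIV_cong_ev[OF refl _ refl])
  qed
  moreover have "\<exists>h. C_k_on l n U h \<and>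
      (\<forall>x\<in>U. ((\<lambda>t. g (x(i := t))) has_real_derivative h x) (at (x i)))" if i: "i < n" for i
  proof -
    obtain h where h: "\<And>i. i < n \<Longrightarrow> C_k_on l n U (h i)" "\<And>i x. i < n \<Longrightarrow> x \<in> U \<Longrightarrow>
        ((\<lambda>t. f (x(i := t))) has_real_derivative h i x) (at (x i))"
      using C_k_on_SucE[OF U f[unfolded Suc]] by blast
    show ?thesis using * h i by (intro exI[of _ "h i"]) simp
  qed
  ultimately show ?thesis unfolding Suc C_k_on_Suc_iff[OF U] by simp
qed

lemma C_k_on_subset:
  assumes U: "openin (Euclidean_space n) U" and V: "openin (Euclidean_space n) V" "V \<subseteq> U"
    and "C_k_on k n U f"
  shows "C_k_on k n V f"
  using assms(4)
proof (induction k arbitrary: f)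
  case 0
  then show ?case using continuous_on_subset[OF _ V(2)] by (simp add: C_k_on_0_iff U V)
next
  case (Suc k)
  obtain g where "\<And>i. i < n \<Longrightarrow> C_k_on k n U (g i)" "\<And>i x. i < n \<Longrightarrow> x \<in> U \<Longrightarrow>
      ((\<lambda>t. f (x(i := t))) has_real_derivative g i x) (at (x i))"
    using C_k_on_SucE[OF U Suc.prems] by blast
  moreover have "continuous_on V f"
    using continuous_on_subset[OF C_k_on_imp_continuous_on[OF U Suc.prems] V(2)] .
  ultimately show ?case
    unfolding C_k_on_Suc_iff[OF V(1)] using V(2) Suc.IH by (auto intro!: exI[of _ "g _"])
qed

text \<open>Continuity is local because relatively open sets do not change the filter
  \<open>at x within U\<close>. For the step from k to k + 1, the locally given partial derivatives
  have to be united into one function on \<open>U\<close>.\<close>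

lemma C_k_on_local:
  assumes U: "openin (Euclidean_space n) U"
    and loc: "\<And>x. x \<in> U \<Longrightarrow> \<exists>V. openin (Euclidean_space n) V \<and> x \<in> V \<and> V \<subseteq> U \<and> C_k_on k n V f"
  shows "C_k_on k n U f"
proof -
  have cont: "continuous_on U h"
    if loc': "\<And>x. x \<in> U \<Longrightarrow>
      \<exists>V. openin (Euclidean_space n) V \<and> x \<in> V \<and> V \<subseteq> U \<and> continuous_on V h"
    for h :: "(nat \<Rightarrow> real) \<Rightarrow> real"
    unfolding continuous_on_eq_continuous_within
  proof
    fix x assume "x \<in> U"
    then obtain V where V: "openin (Euclidean_space n) V" "x \<in> V" "V \<subseteq> U" "continuous_on V h"
      using loc' by blast
    then obtain T where T: "open T" "V = {x. \<forall>i\<ge>n. x i = 0} \<inter> T"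
      unfolding Euclidean_space_eq_top_of_set openin_open by blast
    have "at x within U = at x within V"
      using T V openin_Euclidean_space_subset[OF U] by (intro at_within_nhd[of x T]) blast+
    then show "continuous (at x within U) h"
      using V(2,4) by (simp add: continuous_on_eq_continuous_within)
  qed
  show ?thesis using loc
  proof (induction k arbitrary: f)
    case 0
    have "continuous_on U f"
      using 0 C_k_on_imp_continuous_on by (intro cont) meson
    then show ?case by (simp add: C_k_on_0_iff U)
  next
    case (Suc k)
    have "continuous_on U f"
      using Suc.prems C_k_on_imp_continuous_on by (intro cont) meson
    moreover have "\<exists>g. C_k_on k n U g \<and>
        (\<forall>x\<in>U. ((\<lambda>t. f (x(i := t))) has_real_derivative g x) (at (x i)))" if i: "i < n" for i
    proof -
      \<comment> \<open>The local witnesses depend on the neighbourhood. By uniqueness of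
        derivatives each of them agrees there with this one global candidate.\<close>
      define g where "g x = deriv (\<lambda>t. f (x(i := t))) (x i)" for x
      have *: "\<exists>V. openin (Euclidean_space n) V \<and> x \<in> V \<and> V \<subseteq> U \<and> C_k_on k n V g \<and>
          ((\<lambda>t. f (x(i := t))) has_real_derivative g x) (at (x i))" if x: "x \<in> U" for x
      proof -
        obtain V where V: "openin (Euclidean_space n) V" "x \<in> V" "V \<subseteq> U" "C_k_on (Suc k) n V f"
          using Suc.prems[OF x] by blast
        then obtain g' where g': "C_k_on k n V g'"
          "\<And>x. x \<in> V \<Longrightarrow> ((\<lambda>t. f (x(i := t))) has_real_derivative g' x) (at (x i))"
          using i unfolding C_k_on_Suc_iff[OF V(1)] by blast
        have "g' y = g y" if "y \<in> V" for y
          using g'(2)[OF that] by (simp add: g_def DERIV_imp_deriv)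
        then show ?thesis using V g' C_k_on_cong[OF V(1) _ g'(1), of g] by (metis (no_types, lifting))
      qed
      then have "C_k_on k n U g" by (intro Suc.IH) blast
      then show ?thesis using * by blast
    qed
    ultimately show ?case unfolding C_k_on_Suc_iff[OF U] by blast
  qed
qed

lemma C_k_on_SucD:
  assumes U: "openin (Euclidean_space n) U" and "C_k_on (Suc k) n U f"
  shows "C_k_on k n U f"
  using assms(2)
proof (induction k arbitrary: f)
  case 0
  then show ?case using C_k_on_imp_continuous_on[OF U] by (simp add: C_k_on_0_iff U)
next
  case (Suc k)
  then show ?case unfolding C_k_on_Suc_iff[OF U, of k f] C_k_on_Suc_iff[OF U, of "Suc k"] by blast
qed

lemma C_k_on_const:
  assumes U: "openin (Euclidean_space n) U"
  shows "C_k_on k n U (\<lambda>_. c)"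
proof (induction k arbitrary: c)
  case 0
  then show ?case by (simp add: C_k_on_0_iff U)
next
  case (Suc k)
  show ?case unfolding C_k_on_Suc_iff[OF U]
    by (intro conjI allI impI exI[of _ "\<lambda>_. 0"] Suc continuous_on_const ballI DERIV_const)
qed

lemma C_k_on_add:
  assumes U: "openin (Euclidean_space n) U" and "C_k_on k n U f" "C_k_on k n U g"
  shows "C_k_on k n U (\<lambda>x. f x + g x)"
  using assms(2,3)
proof (induction k arbitrary: f g)
  case 0
  then show ?case by (simp add: C_k_on_0_iff U continuous_on_add)
next
  case (Suc k)
  obtain f' where f': "\<And>i. i < n \<Longrightarrow> C_k_on k n U (f' i)"
    "\<And>i x. i < n \<Longrightarrow> x \<in> U \<Longrightarrow> ((\<lambda>t. f (x(i := t))) has_real_derivative f' i x) (at (x i))"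
    using C_k_on_SucE[OF U Suc.prems(1)] by blast
  obtain g' where g': "\<And>i. i < n \<Longrightarrow> C_k_on k n U (g' i)"
    "\<And>i x. i < n \<Longrightarrow> x \<in> U \<Longrightarrow> ((\<lambda>t. g (x(i := t))) has_real_derivative g' i x) (at (x i))"
    using C_k_on_SucE[OF U Suc.prems(2)] by blast
  show ?case unfolding C_k_on_Suc_iff[OF U]
  proof (intro conjI allI impI)
    show "continuous_on U (\<lambda>x. f x + g x)"
      using Suc.prems by (intro continuous_on_add C_k_on_imp_continuous_on[OF U])
    fix i assume i: "i < n"
    have "((\<lambda>t. f (x(i := t)) + g (x(i := t))) has_real_derivative
        (f' i x + g' i x)) (at (x i))" if "x \<in> U" for x
      using DERIV_add[OF f'(2)[OF i that] g'(2)[OF i that]] .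
    moreover have "C_k_on k n U (\<lambda>x. f' i x + g' i x)"
      using Suc.IH[OF f'(1)[OF i] g'(1)[OF i]] .
    ultimately show "\<exists>h. C_k_on k n U h \<and> (\<forall>x\<in>U. ((\<lambda>t. f (x(i := t)) + g (x(i := t)))
        has_real_derivative h x) (at (x i)))" by blast
  qed
qed

lemma C_k_on_mult:
  assumes U: "openin (Euclidean_space n) U" and "C_k_on k n U f" "C_k_on k n U g"
  shows "C_k_on k n U (\<lambda>x. f x * g x)"
  using assms(2,3)
proof (induction k arbitrary: f g)
  case 0
  then show ?case by (simp add: C_k_on_0_iff U continuous_on_mult)
next
  case (Suc k)
  obtain f' where f': "\<And>i. i < n \<Longrightarrow> C_k_on k n U (f' i)"
    "\<And>i x. i < n \<Longrightarrow> x \<in> U \<Longrightarrow> ((\<lambda>t. f (x(i := t))) has_real_derivative f' i x) (at (x i))"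
    using C_k_on_SucE[OF U Suc.prems(1)] by blast
  obtain g' where g': "\<And>i. i < n \<Longrightarrow> C_k_on k n U (g' i)"
    "\<And>i x. i < n \<Longrightarrow> x \<in> U \<Longrightarrow> ((\<lambda>t. g (x(i := t))) has_real_derivative g' i x) (at (x i))"
    using C_k_on_SucE[OF U Suc.prems(2)] by blast
  show ?case unfolding C_k_on_Suc_iff[OF U]
  proof (intro conjI allI impI)
    show "continuous_on U (\<lambda>x. f x * g x)"
      using Suc.prems by (intro continuous_on_mult C_k_on_imp_continuous_on[OF U])
    fix i assume i: "i < n"
    have "((\<lambda>t. f (x(i := t)) * g (x(i := t))) has_real_derivative
        (f' i x * g x + g' i x * f x)) (at (x i))" if "x \<in> U" for x
      using DERIV_mult'[OF f'(2)[OF i that] g'(2)[OF i that]] by (simp add: algebra_simps)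
    moreover have "C_k_on k n U (\<lambda>x. f' i x * g x + g' i x * f x)"
      using C_k_on_add[OF U Suc.IH[OF f'(1)[OF i] C_k_on_SucD[OF U Suc.prems(2)]]
          Suc.IH[OF g'(1)[OF i] C_k_on_SucD[OF U Suc.prems(1)]]] .
    ultimately show "\<exists>h. C_k_on k n U h \<and> (\<forall>x\<in>U. ((\<lambda>t. f (x(i := t)) * g (x(i := t)))
        has_real_derivative h x) (at (x i)))" by blast
  qed
qed

lemma C_k_on_sum:
  assumes U: "openin (Euclidean_space n) U" and "\<And>j. j \<in> J \<Longrightarrow> C_k_on k n U (f j)"
  shows "C_k_on k n U (\<lambda>x. \<Sum>j\<in>J. f j x)"
  using assms(2)
proof (induction J rule: infinite_finite_induct)
  case (insert j J)
  then have "C_k_on k n U (\<lambda>x. f j x + (\<Sum>j\<in>J. f j x))" by (intro C_k_on_add[OF U]) simp_all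
  then show ?case using insert.hyps by simp
qed (simp_all add: C_k_on_const[OF U])

text \<open>The derivative of 1/f is a polynomial in f' and 1/f, so the induction hypothesis for the
  same \<open>f\<close> already supplies the factor 1/f.\<close>

lemma C_k_on_inverse:
  assumes U: "openin (Euclidean_space n) U" and "C_k_on k n U f" and "\<And>x. x \<in> U \<Longrightarrow> f x \<noteq> 0"
  shows "C_k_on k n U (\<lambda>x. inverse (f x))"
  using assms(2)
proof (induction k)
  case 0
  then show ?case using assms(3) by (simp add: C_k_on_0_iff U continuous_on_inverse)
next
  case (Suc k)
  obtain f' where f': "\<And>i. i < n \<Longrightarrow> C_k_on k n U (f' i)"
    "\<And>i x. i < n \<Longrightarrow> x \<in> U \<Longrightarrow> ((\<lambda>t. f (x(i := t))) has_real_derivative f' i x) (at (x i))"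
    using C_k_on_SucE[OF U Suc.prems] by blast
  have inv: "C_k_on k n U (\<lambda>x. inverse (f x))"
    using Suc C_k_on_SucD[OF U] by blast
  show ?case unfolding C_k_on_Suc_iff[OF U]
  proof (intro conjI allI impI)
    show "continuous_on U (\<lambda>x. inverse (f x))"
      using C_k_on_imp_continuous_on[OF U inv] .
    fix i assume i: "i < n"
    have "((\<lambda>t. inverse (f (x(i := t)))) has_real_derivative
        ((-1) * (f' i x * (inverse (f x) * inverse (f x))))) (at (x i))" if "x \<in> U" for x
      using DERIV_inverse_fun[OF f'(2)[OF i that]] assms(3)[OF that] by (simp add: algebra_simps power2_eq_square)
    moreover have "C_k_on k n U (\<lambda>x. (-1) * (f' i x * (inverse (f x) * inverse (f x))))"
      using f'(1)[OF i] inv by (intro C_k_on_mult[OF U] C_k_on_const[OF U])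
    ultimately show "\<exists>h. C_k_on k n U h \<and> (\<forall>x\<in>U. ((\<lambda>t. inverse (f (x(i := t))))
        has_real_derivative h x) (at (x i)))" by blast
  qed
qed

text \<open>Telescoping over the coordinates reduces the chain rule to the mean value theorem in one
  variable; continuity of the partial derivatives is what makes the difference quotients converge.\<close>

lemma has_real_derivative_compose_partials:
  fixes \<gamma> :: "real \<Rightarrow> nat \<Rightarrow> real"
  assumes U: "openin (Euclidean_space n) U" and x: "\<gamma> t\<^sub>0 \<in> U"
    and \<gamma>0: "\<And>t i. i \<ge> n \<Longrightarrow> \<gamma> t i = 0"
    and \<gamma>: "\<And>i. i < n \<Longrightarrow> ((\<lambda>t. \<gamma> t i) has_real_derivative \<gamma>' i) (at t\<^sub>0)"
    and cont: "\<And>i. i < n \<Longrightarrow> continuous_on U (g i)"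
    and g: "\<And>i x. i < n \<Longrightarrow> x \<in> U \<Longrightarrow>
       ((\<lambda>t. p (x(i := t))) has_real_derivative g i x) (at (x i))"
  shows "((\<lambda>t. p (\<gamma> t)) has_real_derivative (\<Sum>i<n. g i (\<gamma> t\<^sub>0) * \<gamma>' i)) (at t\<^sub>0)"
proof -
  \<comment> \<open>The coordinates below \<open>k\<close> have moved to time \<open>t\<close>, the
    others still stand at time \<open>t\<^sub>0\<close>; consecutive points differ in one
    coordinate.\<close>
  define z where "z k t i = (if i < k then \<gamma> t i else \<gamma> t\<^sub>0 i)" for k t i
  have z0: "z k t\<^sub>0 = \<gamma> t\<^sub>0" for k by (auto simp: z_def)
  have "((\<lambda>t. p (z k t)) has_real_derivative (\<Sum>i<k. g i (\<gamma> t\<^sub>0) * \<gamma>' i)) (at t\<^sub>0)"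
    if "k \<le> n" for k using that
  proof (induction k)
    case 0
    then show ?case by (simp add: z_def)
  next
    case (Suc k)
    then have k: "k < n" by simp
    define D where "D t = p (z (Suc k) t) - p (z k t)" for t
    \<comment> \<open>A difference quotient in the style of Caratheodory: where coordinate
      \<open>k\<close> has not moved, it is given the partial derivative as value, so that
      \<open>Dq\<close> holds without a case of division by zero.\<close>
    define q where "q t = (if \<gamma> t k = \<gamma> t\<^sub>0 k then g k (\<gamma> t\<^sub>0) else D t / (\<gamma> t k - \<gamma> t\<^sub>0 k))" for t
    have zS: "z (Suc k) t = (z k t)(k := \<gamma> t k)" and zk: "z k t = (z k t)(k := \<gamma> t\<^sub>0 k)" for t
      by (auto simp: z_def less_Suc_eq)
    have Dq: "D t = q t * (\<gamma> t k - \<gamma> t\<^sub>0 k)" for t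
      using zS[of t] zk[of t] by (auto simp: q_def D_def)
    have "(q \<longlongrightarrow> g k (\<gamma> t\<^sub>0)) (at t\<^sub>0)"
    proof (rule tendstoI)
      fix e :: real assume "e > 0"
      let ?W = "U \<inter> g k -` ball (g k (\<gamma> t\<^sub>0)) e"
      have "openin (top_of_set U) ?W"
        using cont[OF k] continuous_on_open_gen by (auto intro!: continuous_openin_preimage_gen)
      moreover have "openin (top_of_set {x. \<forall>i\<ge>n. x i = 0}) U"
        using U by (simp add: Euclidean_space_eq_top_of_set)
      ultimately have "openin (Euclidean_space n) ?W"
        unfolding Euclidean_space_eq_top_of_set by (rule openin_trans)
      moreover have "\<gamma> t\<^sub>0 \<in> ?W" using x \<open>e > 0\<close> by simp
      ultimately obtain d where d: "d > 0"
        "\<And>y. \<forall>i\<ge>n. y i = 0 \<Longrightarrow> \<forall>i<n. \<bar>y i - \<gamma> t\<^sub>0 i\<bar> < d \<Longrightarrow> y \<in> ?W"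
        using openin_Euclidean_space_box by metis
      have "\<forall>\<^sub>F t in at t\<^sub>0. \<bar>\<gamma> t i - \<gamma> t\<^sub>0 i\<bar> < d" if "i < n" for i
        using DERIV_isCont[OF \<gamma>[OF that]] d(1)
        by (auto simp: isCont_def tendsto_iff dist_real_def)
      then have "\<forall>\<^sub>F t in at t\<^sub>0. \<forall>i\<in>{..<n}. \<bar>\<gamma> t i - \<gamma> t\<^sub>0 i\<bar> < d"
        by (intro eventually_ball_finite) auto
      then show "\<forall>\<^sub>F t in at t\<^sub>0. dist (q t) (g k (\<gamma> t\<^sub>0)) < e"
      proof eventually_elim
        case (elim t)
        have inW: "(z k t)(k := s) \<in> ?W" if "\<bar>s - \<gamma> t\<^sub>0 k\<bar> \<le> \<bar>\<gamma> t k - \<gamma> t\<^sub>0 k\<bar>" for s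
          using elim that k \<gamma>0 d(1) by (intro d(2)) (auto simp: z_def intro: le_less_trans)
        have der: "((\<lambda>r. p ((z k t)(k := r))) has_real_derivative g k ((z k t)(k := s))) (at s)"
          if "\<bar>s - \<gamma> t\<^sub>0 k\<bar> \<le> \<bar>\<gamma> t k - \<gamma> t\<^sub>0 k\<bar>" for s
          using g[OF k, of "(z k t)(k := s)"] inW[OF that] by simp
        show ?case
        proof (cases "\<gamma> t k = \<gamma> t\<^sub>0 k")
          case True
          then show ?thesis using \<open>e > 0\<close> by (simp add: q_def)
        next
          case False
          have "\<exists>s. \<bar>s - \<gamma> t\<^sub>0 k\<bar> \<le> \<bar>\<gamma> t k - \<gamma> t\<^sub>0 k\<bar> \<and>
              D t = (\<gamma> t k - \<gamma> t\<^sub>0 k) * g k ((z k t)(k := s))"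
          proof (cases "\<gamma> t k < \<gamma> t\<^sub>0 k")
            case True
            have "\<exists>s. \<gamma> t k < s \<and> s < \<gamma> t\<^sub>0 k \<and> p ((z k t)(k := \<gamma> t\<^sub>0 k)) - p ((z k t)(k := \<gamma> t k)) =
                (\<gamma> t\<^sub>0 k - \<gamma> t k) * g k ((z k t)(k := s))"
              using True by (intro MVT2 der) auto
            then obtain s where s: "\<gamma> t k < s" "s < \<gamma> t\<^sub>0 k"
              "p ((z k t)(k := \<gamma> t\<^sub>0 k)) - p ((z k t)(k := \<gamma> t k)) =
                (\<gamma> t\<^sub>0 k - \<gamma> t k) * g k ((z k t)(k := s))" by blast
            then have "D t = (\<gamma> t k - \<gamma> t\<^sub>0 k) * g k ((z k t)(k := s))"
              using zk[of t] by (simp add: D_def zS algebra_simps)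
            then show ?thesis using s True by (intro exI[of _ s]) auto
          next
            case False
            with \<open>\<gamma> t k \<noteq> \<gamma> t\<^sub>0 k\<close> have lt: "\<gamma> t\<^sub>0 k < \<gamma> t k" by simp
            have "\<exists>s>\<gamma> t\<^sub>0 k. s < \<gamma> t k \<and> p ((z k t)(k := \<gamma> t k)) - p ((z k t)(k := \<gamma> t\<^sub>0 k)) =
                (\<gamma> t k - \<gamma> t\<^sub>0 k) * g k ((z k t)(k := s))"
              using lt by (intro MVT2 der) auto
            then obtain s where s: "\<gamma> t\<^sub>0 k < s" "s < \<gamma> t k"
              "p ((z k t)(k := \<gamma> t k)) - p ((z k t)(k := \<gamma> t\<^sub>0 k)) =
                (\<gamma> t k - \<gamma> t\<^sub>0 k) * g k ((z k t)(k := s))" by blast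
            then have "D t = (\<gamma> t k - \<gamma> t\<^sub>0 k) * g k ((z k t)(k := s))"
              using zk[of t] by (simp add: D_def zS)
            then show ?thesis using s lt by (intro exI[of _ s]) auto
          qed
          then obtain s where s: "\<bar>s - \<gamma> t\<^sub>0 k\<bar> \<le> \<bar>\<gamma> t k - \<gamma> t\<^sub>0 k\<bar>"
              "D t = (\<gamma> t k - \<gamma> t\<^sub>0 k) * g k ((z k t)(k := s))" by blast
          have "q t = g k ((z k t)(k := s))" using s(2) False by (simp add: q_def)
          then show ?thesis using inW[OF s(1)] by (simp add: dist_commute)
        qed
      qed
    qed
    moreover have "((\<lambda>t. (\<gamma> t k - \<gamma> t\<^sub>0 k) / (t - t\<^sub>0)) \<longlongrightarrow> \<gamma>' k) (at t\<^sub>0)"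
      using \<gamma>[OF k] by (simp add: has_field_derivative_iff)
    ultimately have "((\<lambda>t. q t * ((\<gamma> t k - \<gamma> t\<^sub>0 k) / (t - t\<^sub>0))) \<longlongrightarrow> g k (\<gamma> t\<^sub>0) * \<gamma>' k) (at t\<^sub>0)"
      by (rule tendsto_mult)
    moreover have "D t\<^sub>0 = 0" by (simp add: D_def z0)
    ultimately have "(D has_real_derivative g k (\<gamma> t\<^sub>0) * \<gamma>' k) (at t\<^sub>0)"
      by (simp add: has_field_derivative_iff Dq)
    from DERIV_add[OF Suc.IH this] k show ?case by (simp add: D_def)
  qed
  from this[of n] have "((\<lambda>t. p (z n t)) has_real_derivative (\<Sum>i<n. g i (\<gamma> t\<^sub>0) * \<gamma>' i)) (at t\<^sub>0)"
    by simp
  moreover have "z n t = \<gamma> t" for t by (auto simp: z_def \<gamma>0)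
  ultimately show ?thesis by simp
qed

lemma continuous_on_into_Euclidean_space:
  fixes f :: "'a::topological_space \<Rightarrow> nat \<Rightarrow> real"
  assumes U: "openin (Euclidean_space n) U" and fVU: "f ` V \<subseteq> U"
    and f: "\<And>i. i < n \<Longrightarrow> continuous_on V (\<lambda>x. f x i)"
  shows "continuous_on V f"
proof (rule continuous_on_coordinatewise_then_product)
  have f0: "f x i = 0" if "x \<in> V" "i \<ge> n" for x i
    using that fVU openin_Euclidean_space_subset[OF U] by blast
  fix i
  show "continuous_on V (\<lambda>x. f x i)"
  proof (cases "i < n")
    case False
    then have "continuous_on V (\<lambda>x. f x i) \<longleftrightarrow> continuous_on V (\<lambda>_. 0 :: real)"
      by (intro continuous_on_cong) (auto simp: f0)
    then show ?thesis by simp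
  qed (rule f)
qed

text \<open>By the chain rule the partial derivatives are sums of products of \<open>g i\<close>
  composed with \<open>f\<close> and partial derivatives of \<open>f\<close>. The \<open>g i\<close>
  are again of class C^k, so the induction runs over all outer functions \<open>p\<close> while
  \<open>f\<close> is lowered to class C^k.\<close>

lemma C_k_on_compose:
  assumes V: "openin (Euclidean_space m) V" and U: "openin (Euclidean_space n) U"
    and fVU: "f ` V \<subseteq> U" and f: "\<And>i. i < n \<Longrightarrow> C_k_on k m V (\<lambda>x. f x i)"
    and p: "C_k_on k n U p"
  shows "C_k_on k m V (\<lambda>x. p (f x))"
proof -
  have f0: "f x i = 0" if "x \<in> V" "i \<ge> n" for x i
    using that fVU openin_Euclidean_space_subset[OF U] by blast
  have contf: "continuous_on V f" if "\<And>i. i < n \<Longrightarrow> C_k_on k m V (\<lambda>x. f x i)" for k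
    using C_k_on_imp_continuous_on[OF V that]
    by (rule continuous_on_into_Euclidean_space[OF U fVU])
  have cont: "continuous_on V (\<lambda>x. p (f x))"
    if "\<And>i. i < n \<Longrightarrow> C_k_on k m V (\<lambda>x. f x i)" "C_k_on k n U p" for k p
    using continuous_on_compose2[OF C_k_on_imp_continuous_on[OF U that(2)] contf[OF that(1)]] fVU
    by auto
  from f p show ?thesis
  proof (induction k arbitrary: p)
    case 0
    then show ?case using cont[OF 0] by (simp add: C_k_on_0_iff V)
  next
    case (Suc k)
    obtain g where g: "\<And>i. i < n \<Longrightarrow> C_k_on k n U (g i)"
      "\<And>i x. i < n \<Longrightarrow> x \<in> U \<Longrightarrow> ((\<lambda>t. p (x(i := t))) has_real_derivative g i x) (at (x i))"
      using C_k_on_SucE[OF U Suc.prems(2)] by blast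
    have "\<exists>f'. C_k_on k m V f' \<and>
        (\<forall>x\<in>V. ((\<lambda>t. f (x(j := t)) i) has_real_derivative f' x) (at (x j)))"
      if "i < n" "j < m" for i j
      using Suc.prems(1)[OF that(1)] that(2) unfolding C_k_on_Suc_iff[OF V] by blast
    then obtain f' where f': "\<And>i j. i < n \<Longrightarrow> j < m \<Longrightarrow> C_k_on k m V (f' i j)"
      "\<And>i j x. i < n \<Longrightarrow> j < m \<Longrightarrow> x \<in> V \<Longrightarrow>
        ((\<lambda>t. f (x(j := t)) i) has_real_derivative f' i j x) (at (x j))"
      by metis
    show ?case unfolding C_k_on_Suc_iff[OF V]
    proof (intro conjI allI impI)
      show "continuous_on V (\<lambda>x. p (f x))" using cont[OF Suc.prems] .
      fix j assume j: "j < m"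
      have "((\<lambda>t. p (f (x(j := t)))) has_real_derivative
          (\<Sum>i<n. g i (f x) * f' i j x)) (at (x j))" if x: "x \<in> V" for x
      proof -
        \<comment> \<open>For \<open>t\<close> far from \<open>x j\<close> the point leaves
          \<open>V\<close>, where \<open>f\<close> may take values outside
          \<open>Euclidean_space n\<close>. Cutting off the coordinates from \<open>n\<close> on
          gives a curve in this space for all \<open>t\<close>, unchanged near
          \<open>x j\<close>.\<close>
        define \<gamma> where "\<gamma> t i = (if i < n then f (x(j := t)) i else 0)" for t i
        have \<gamma>: "\<gamma> t = f (x(j := t))" if "x(j := t) \<in> V" for t
          using f0[OF that] by (auto simp: \<gamma>_def)
        then have \<gamma>x: "\<gamma> (x j) = f x" using x by simp
        have "((\<lambda>t. p (\<gamma> t)) has_real_derivative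
            (\<Sum>i<n. g i (\<gamma> (x j)) * f' i j x)) (at (x j))"
        proof (rule has_real_derivative_compose_partials[OF U])
          show "\<gamma> (x j) \<in> U" using \<gamma>x x fVU by auto
          show "((\<lambda>t. \<gamma> t i) has_real_derivative f' i j x) (at (x j))" if "i < n" for i
            using f'(2)[OF that j x] that by (simp add: \<gamma>_def)
          show "continuous_on U (g i)" if "i < n" for i
            using g(1)[OF that] C_k_on_imp_continuous_on[OF U] by blast
          show "((\<lambda>t. p (y(i := t))) has_real_derivative g i y) (at (y i))" if "i < n" "y \<in> U" for i y
            using g(2) that .
        qed (simp add: \<gamma>_def)
        moreover have "\<forall>\<^sub>F t in nhds (x j). p (\<gamma> t) = p (f (x(j := t)))"
          using eventually_fun_upd_in_openin[OF V x j] by eventually_elim (simp add: \<gamma>)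
        ultimately show ?thesis using DERIV_cong_ev[OF refl] \<gamma>x by fastforce
      qed
      moreover have "C_k_on k m V (\<lambda>x. \<Sum>i<n. g i (f x) * f' i j x)"
      proof (rule C_k_on_sum[OF V], rule C_k_on_mult[OF V])
        fix i assume "i \<in> {..<n}"
        then have i: "i < n" by simp
        show "C_k_on k m V (\<lambda>x. g i (f x))"
          using C_k_on_SucD[OF V Suc.prems(1)] g(1)[OF i] by (rule Suc.IH)
        show "C_k_on k m V (f' i j)" using f'(1)[OF i j] .
      qed
      ultimately show "\<exists>h. C_k_on k m V h \<and> (\<forall>x\<in>V. ((\<lambda>t. p (f (x(j := t))))
          has_real_derivative h x) (at (x j)))" by blast
    qed
  qed
qed

text \<open>A smooth function of one variable is represented by the sequence \<open>H\<close> of its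
  successive derivatives. Differentiating shifts the index, so the induction on \<open>k\<close> has
  to range over all \<open>l\<close>.\<close>

lemma C_k_on_affine_coordinate:
  fixes H :: "nat \<Rightarrow> real \<Rightarrow> real"
  assumes U: "openin (Euclidean_space n) U"
    and H: "\<And>l x. (H l has_real_derivative H (Suc l) x) (at x)"
  shows "C_k_on k n U (\<lambda>x. H l (a * x j + b))"
proof (induction k arbitrary: l)
  case 0
  have "isCont (H l) x" for x using H[of l x] by (rule DERIV_isCont)
  then have "continuous_on UNIV (H l)" by (simp add: continuous_on_eq_continuous_at)
  moreover have "continuous_on U (\<lambda>x. a * x j + b)"
    using continuous_on_subset[OF continuous_on_product_coordinates subset_UNIV, of U j]
    by (intro continuous_on_add continuous_on_mult continuous_on_const)
  ultimately have "continuous_on U (\<lambda>x. H l (a * x j + b))"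
    by (rule continuous_on_compose2) simp
  then show ?case by (simp add: C_k_on_0_iff U)
next
  case (Suc k)
  show ?case unfolding C_k_on_Suc_iff[OF U]
  proof (intro conjI allI impI)
    show "continuous_on U (\<lambda>x. H l (a * x j + b))" using Suc C_k_on_imp_continuous_on[OF U] by blast
    fix i assume "i < n"
    show "\<exists>g. C_k_on k n U g \<and> (\<forall>x\<in>U. ((\<lambda>t. H l (a * (x(i := t)) j + b))
        has_real_derivative g x) (at (x i)))"
    proof (cases "i = j")
      case True
      have "((\<lambda>t. H l (a * t + b)) has_real_derivative a * H (Suc l) (a * s + b)) (at s)" for s
      proof -
        have "((\<lambda>t. a * t + b) has_real_derivative a) (at s)"
          by (auto intro!: derivative_eq_intros)
        from DERIV_chain2[OF H this] show ?thesis by (simp add: mult.commute)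
      qed
      then show ?thesis using True C_k_on_mult[OF U C_k_on_const[OF U] Suc]
        by (intro exI[of _ "\<lambda>x. a * H (Suc l) (a * x j + b)"]) auto
    next
      case False
      then show ?thesis using C_k_on_const[OF U] by (intro exI[of _ "\<lambda>_. 0"]) auto
    qed
  qed
qed

section \<open>Smooth real functions and smooth maps\<close>

lemma smooth_real_on_openin: "smooth_real_on n U f \<Longrightarrow> openin (Euclidean_space n) U"
  by (simp add: smooth_real_on_def)

lemma smooth_real_on_continuous: "smooth_real_on n U f \<Longrightarrow> continuous_on U f"
  unfolding smooth_real_on_def using C_k_on_imp_continuous_on by blast

lemma smooth_real_on_const: "openin (Euclidean_space n) U \<Longrightarrow> smooth_real_on n U (\<lambda>_. c)"
  by (simp add: smooth_real_on_def C_k_on_const)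

lemma smooth_real_on_add:
  "smooth_real_on n U f \<Longrightarrow> smooth_real_on n U g \<Longrightarrow> smooth_real_on n U (\<lambda>x. f x + g x)"
  by (simp add: smooth_real_on_def C_k_on_add)

lemma smooth_real_on_mult:
  "smooth_real_on n U f \<Longrightarrow> smooth_real_on n U g \<Longrightarrow> smooth_real_on n U (\<lambda>x. f x * g x)"
  by (simp add: smooth_real_on_def C_k_on_mult)

lemma smooth_real_on_inverse:
  "smooth_real_on n U f \<Longrightarrow> (\<And>x. x \<in> U \<Longrightarrow> f x \<noteq> 0) \<Longrightarrow> smooth_real_on n U (\<lambda>x. inverse (f x))"
  by (simp add: smooth_real_on_def C_k_on_inverse)

lemma smooth_real_on_cong:
  "smooth_real_on n U f \<Longrightarrow> (\<And>x. x \<in> U \<Longrightarrow> f x = g x) \<Longrightarrow> smooth_real_on n U g"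
  unfolding smooth_real_on_def using C_k_on_cong by blast

lemma smooth_real_on_compose:
  "smooth_euclidean m V n U f \<Longrightarrow> smooth_real_on n U p \<Longrightarrow> smooth_real_on m V (p \<circ> f)"
  unfolding smooth_euclidean_def smooth_real_on_def using C_k_on_compose[of m V n U f _ p]
  by (simp add: comp_def)

lemma smooth_real_on_local:
  assumes "locally_on n U (\<lambda>V. smooth_real_on n V p)"
  shows "smooth_real_on n U p"
  using assms C_k_on_local[of n U] unfolding locally_on_def smooth_real_on_def by meson

lemma smooth_real_on_affine_coordinate:
  assumes U: "openin (Euclidean_space n) U"
  shows "smooth_real_on n U (\<lambda>x. a * x j + b)"
proof -
  define H where "H l = (if l = 0 then \<lambda>x. x else if l = 1 then \<lambda>_. 1 else (\<lambda>_. 0 :: real))" for l :: nat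
  have "(H l has_real_derivative H (Suc l) x) (at x)" for l x
    by (cases l) (auto simp: H_def)
  from C_k_on_affine_coordinate[where H = H and l = 0 and a = a and b = b and j = j, OF U this] U show ?thesis
    by (simp add: smooth_real_on_def H_def)
qed

lemma smooth_real_on_coordinate:
  "openin (Euclidean_space n) U \<Longrightarrow> smooth_real_on n U (\<lambda>x. x j)"
  using smooth_real_on_affine_coordinate[of n U 1 j 0] by simp

lemma smooth_euclidean_inclusion:
  assumes "openin (Euclidean_space n) V" "openin (Euclidean_space n) U" "V \<subseteq> U"
  shows "smooth_euclidean n V n U id"
  using assms smooth_real_on_coordinate by (auto simp: smooth_euclidean_def)


section \<open>A smooth step function\<close>

text \<open>The case \<open>P = 1\<close> is the familiar flat function exp(-1/x), continued by 0.
  The polynomial factor makes the family closed under differentiation.\<close>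

definition flat_exp :: "real poly \<Rightarrow> real \<Rightarrow> real" where
  "flat_exp P x = (if x > 0 then poly P (1 / x) * exp (- (1 / x)) else 0)"

lemma tendsto_poly_mult_exp_minus: "((\<lambda>y. poly P y * exp (- y)) \<longlongrightarrow> (0::real)) at_top"
proof (induction P)
  case 0
  then show ?case by simp
next
  case (pCons a P)
  have "((\<lambda>y. \<Sum>i\<le>degree (pCons a P). coeff (pCons a P) i * (y ^ i / exp y)) \<longlongrightarrow>
      (\<Sum>i\<le>degree (pCons a P). coeff (pCons a P) i * (0::real))) at_top"
    by (intro tendsto_sum tendsto_mult_left tendsto_power_div_exp_0)
  then show ?case
    by (simp add: poly_altdef exp_minus divide_inverse sum_distrib_right mult.assoc del: coeff_pCons poly_pCons)
qed

text \<open>Substituting \<open>y = 1 / x\<close>, the operator \<open>d/dx\<close> becomes \<open>- y\<^sup>2 d/dy\<close>.\<close>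

lemma flat_exp_has_derivative:
  "(flat_exp P has_real_derivative flat_exp ([:0, 0, 1:] * (P - pderiv P)) x) (at x)"
proof -
  let ?Q = "[:0, 0, 1:] * (P - pderiv P)"
  consider "x > 0" | "x < 0" | "x = 0" by linarith
  then show ?thesis
  proof cases
    case 1
    have "((\<lambda>x. poly P (1 / x) * exp (- (1 / x))) has_real_derivative
        poly ?Q (1 / x) * exp (- (1 / x))) (at x)"
      using 1 by (auto intro!: derivative_eq_intros DERIV_chain2[OF poly_DERIV]
          simp: power2_eq_square field_simps)
    moreover have "\<forall>\<^sub>F y in nhds x. poly P (1 / y) * exp (- (1 / y)) = flat_exp P y"
      using eventually_nhds_in_open[of "{0<..}" x] 1
      by (auto elim!: eventually_mono simp: flat_exp_def)
    ultimately have "(flat_exp P has_real_derivative poly ?Q (1 / x) * exp (- (1 / x))) (at x)"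
      by (simp only: DERIV_cong_ev[OF refl _ refl])
    moreover have "flat_exp ?Q x = poly ?Q (1 / x) * exp (- (1 / x))" using 1 by (simp add: flat_exp_def)
    ultimately show ?thesis by simp
  next
    case 2
    have "\<forall>\<^sub>F y in nhds x. (0 :: real) = flat_exp P y"
      using eventually_nhds_in_open[of "{..<0}" x] 2
      by (auto elim!: eventually_mono simp: flat_exp_def)
    moreover have "((\<lambda>_. 0 :: real) has_real_derivative 0) (at x)" by simp
    ultimately have "(flat_exp P has_real_derivative 0) (at x)"
      by (simp only: DERIV_cong_ev[OF refl _ refl])
    moreover have "flat_exp ?Q x = 0" using 2 by (simp add: flat_exp_def)
    ultimately show ?thesis by simp
  next
    case 3
    \<comment> \<open>The difference quotient at 0 is \<open>flat_exp P y / y\<close>; its factor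
      1/y is absorbed by multiplying \<open>P\<close> with the variable.\<close>
    have "((\<lambda>y. poly (pCons 0 P) y * exp (- y)) \<longlongrightarrow> 0) at_top"
      by (rule tendsto_poly_mult_exp_minus)
    then have "((\<lambda>y. poly (pCons 0 P) (inverse y) * exp (- inverse y)) \<longlongrightarrow> 0) (at_right 0)"
      by (rule filterlim_compose[OF _ filterlim_inverse_at_top_right])
    then have "((\<lambda>y. flat_exp P y / y) \<longlongrightarrow> 0) (at_right 0)"
      by (rule Lim_transform_eventually)
         (auto simp: eventually_at_right_less flat_exp_def field_simps intro!: eventually_at_rightI[of 0 1])
    moreover have "((\<lambda>y. flat_exp P y / y) \<longlongrightarrow> 0) (at_left 0)"
      by (rule Lim_transform_eventually[OF tendsto_const])
         (auto simp: flat_exp_def intro!: eventually_at_leftI[of "-1" 0])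
    ultimately show ?thesis using 3
      by (simp add: has_field_derivative_iff filterlim_at_split flat_exp_def)
  qed
qed

text \<open>One of x and 1 - x is always positive, so the denominator is positive everywhere; for x
  at least 1 its second summand vanishes and the quotient is 1.\<close>

definition smooth_step :: "real \<Rightarrow> real" where
  "smooth_step x = flat_exp 1 x * inverse (flat_exp 1 x + flat_exp 1 (1 - x))"

lemma smooth_step_eq_0: "x \<le> 0 \<Longrightarrow> smooth_step x = 0"
  by (simp add: smooth_step_def flat_exp_def)

lemma smooth_step_eq_1: "x \<ge> 1 \<Longrightarrow> smooth_step x = 1"
  by (simp add: smooth_step_def flat_exp_def)

lemma smooth_real_on_step:
  assumes U: "openin (Euclidean_space n) U"
  shows "smooth_real_on n U (\<lambda>x. smooth_step (a * x j + b))"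
proof -
  \<comment> \<open>The polynomial of the l-th derivative of \<open>flat_exp 1\<close>, obtained by
    iterating the operator in \<open>flat_exp_has_derivative\<close>.\<close>
  define Q where "Q l = ((\<lambda>P. [:0, 0, 1:] * (P - pderiv P)) ^^ l) (1 :: real poly)" for l
  have H: "(flat_exp (Q l) has_real_derivative flat_exp (Q (Suc l)) x) (at x)" for l x
    unfolding Q_def funpow.simps comp_def by (rule flat_exp_has_derivative)
  have flat_exp: "smooth_real_on n U (\<lambda>x. flat_exp 1 (a * x j + b))" for a b
    using C_k_on_affine_coordinate[where H = "\<lambda>l. flat_exp (Q l)", OF U H, of _ 0] U
    by (simp add: smooth_real_on_def Q_def)
  have pos: "flat_exp 1 x + flat_exp 1 (1 - x) \<noteq> 0" for x
  proof -
    have "flat_exp 1 x > 0 \<or> flat_exp 1 (1 - x) > 0" "flat_exp 1 x \<ge> 0" "flat_exp 1 (1 - x) \<ge> 0"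
      by (auto simp: flat_exp_def)
    then show ?thesis by linarith
  qed
  have "1 - (a * x j + b) = (- a) * x j + (1 - b)" for x :: "nat \<Rightarrow> real" by simp
  then have "smooth_real_on n U (\<lambda>x. flat_exp 1 (1 - (a * x j + b)))"
    using flat_exp[of "- a" "1 - b"] by (simp only:)
  then show ?thesis unfolding smooth_step_def
    using pos by (intro smooth_real_on_mult smooth_real_on_inverse smooth_real_on_add flat_exp)
qed

section \<open>Diffeologies\<close>

lemma locally_on_self: "openin (Euclidean_space n) U \<Longrightarrow> P U \<Longrightarrow> locally_on n U P"
  unfolding locally_on_def by blast

lemma locally_on_mono:
  assumes "locally_on n U P" "\<And>V. openin (Euclidean_space n) V \<Longrightarrow> V \<subseteq> U \<Longrightarrow> P V \<Longrightarrow> Q V"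
  shows "locally_on n U Q"
  using assms unfolding locally_on_def by meson

lemma locally_on_idem:
  assumes "locally_on n U (\<lambda>V. locally_on n V P)"
  shows "locally_on n U P"
  unfolding locally_on_def
proof (intro conjI ballI)
  show "openin (Euclidean_space n) U" using assms by (simp add: locally_on_def)
  fix u assume "u \<in> U"
  then obtain V where V: "u \<in> V" "V \<subseteq> U" "locally_on n V P"
    using assms unfolding locally_on_def[of n U] by blast
  then obtain W where "openin (Euclidean_space n) W" "u \<in> W" "W \<subseteq> V" "P W"
    unfolding locally_on_def by blast
  then show "\<exists>V. openin (Euclidean_space n) V \<and> u \<in> V \<and> V \<subseteq> U \<and> P V"
    using V by blast
qed

lemma locally_on_conj:
  assumes "locally_on n U P" "locally_on n U Q"
    and P: "\<And>V W. P V \<Longrightarrow> openin (Euclidean_space n) W \<Longrightarrow> W \<subseteq> V \<Longrightarrow> P W"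
    and Q: "\<And>V W. Q V \<Longrightarrow> openin (Euclidean_space n) W \<Longrightarrow> W \<subseteq> V \<Longrightarrow> Q W"
  shows "locally_on n U (\<lambda>V. P V \<and> Q V)"
  unfolding locally_on_def
proof (intro conjI ballI)
  show "openin (Euclidean_space n) U" using assms(1) by (simp add: locally_on_def)
  fix u assume u: "u \<in> U"
  obtain V where V: "openin (Euclidean_space n) V" "u \<in> V" "V \<subseteq> U" "P V"
    using u assms(1) unfolding locally_on_def by blast
  obtain W where W: "openin (Euclidean_space n) W" "u \<in> W" "W \<subseteq> U" "Q W"
    using u assms(2) unfolding locally_on_def by blast
  have o: "openin (Euclidean_space n) (V \<inter> W)" using V(1) W(1) by (rule openin_Int)
  show "\<exists>V. openin (Euclidean_space n) V \<and> u \<in> V \<and> V \<subseteq> U \<and> P V \<and> Q V"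
    using o V W P[OF V(4) o] Q[OF W(4) o] by (intro exI[of _ "V \<inter> W"]) auto
qed

lemma smooth_euclidean_openin_vimage:
  assumes f: "smooth_euclidean m V n U f" and W: "openin (Euclidean_space n) W"
  shows "openin (Euclidean_space m) (V \<inter> f -` W)"
proof -
  have V: "openin (Euclidean_space m) V" and fVU: "f ` V \<subseteq> U" and U: "openin (Euclidean_space n) U"
    using f by (simp_all add: smooth_euclidean_def)
  have "continuous_on V f"
    using f smooth_real_on_continuous[of m V]
    by (intro continuous_on_into_Euclidean_space[OF U fVU]) (simp add: smooth_euclidean_def)
  obtain T where T: "open T" "W = {x. \<forall>i\<ge>n. x i = 0} \<inter> T"
    using W unfolding Euclidean_space_eq_top_of_set openin_open by blast
  have "openin (top_of_set V) (V \<inter> f -` T)"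
    using \<open>continuous_on V f\<close> T(1) by (rule continuous_openin_preimage_gen)
  then have "openin (Euclidean_space m) (V \<inter> f -` T)"
    using V unfolding Euclidean_space_eq_top_of_set by (rule openin_trans)
  moreover have "V \<inter> f -` T = V \<inter> f -` W"
    using T fVU openin_Euclidean_space_subset[OF U] by auto
  ultimately show ?thesis by simp
qed

lemma smooth_euclidean_restrict:
  assumes f: "smooth_euclidean m V n U f" and W: "openin (Euclidean_space n) W"
  shows "smooth_euclidean m (V \<inter> f -` W) n W f"
  using f W smooth_euclidean_openin_vimage[OF f W] C_k_on_subset[of m V "V \<inter> f -` W"]
  unfolding smooth_euclidean_def smooth_real_on_def by auto

text \<open>Coproduct, quotient and free diffeology are all of the shape "locally of the form B".
  For this shape the gluing axiom is \<open>locally_on_idem\<close>, and openness of domains is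
  built into \<open>locally_on\<close>, so three conditions on the local form remain.\<close>

lemma is_diffeology_locally:
  assumes cong: "\<And>n U p q. B n U p \<Longrightarrow> \<forall>u\<in>U. p u = q u \<Longrightarrow> B n U q"
    and const: "\<And>n U a. openin (Euclidean_space n) U \<Longrightarrow> B n U (\<lambda>_. a)"
    and comp: "\<And>m V n U f p. smooth_euclidean m V n U f \<Longrightarrow> B n U p \<Longrightarrow> B m V (p \<circ> f)"
  shows "is_diffeology (\<lambda>n U p. locally_on n U (\<lambda>V. B n V p))"
  unfolding is_diffeology_def
proof (intro conjI allI impI)
  show "openin (Euclidean_space n) U" if "locally_on n U (\<lambda>V. B n V p)" for n U p
    using that by (simp add: locally_on_def)
  show "locally_on n U (\<lambda>V. B n V q)"
    if "locally_on n U (\<lambda>V. B n V p)" "\<forall>u\<in>U. p u = q u" for n U p q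
    using that by (elim locally_on_mono) (auto intro: cong)
  show "locally_on n U (\<lambda>V. B n V (\<lambda>_. a))" if "openin (Euclidean_space n) U" for n U a
    using that const[OF that] by (rule locally_on_self)
  show "locally_on m V (\<lambda>V. B m V (p \<circ> f))"
    if f: "smooth_euclidean m V n U f" and p: "locally_on n U (\<lambda>V. B n V p)" for m V n U f p
    unfolding locally_on_def
  proof (intro conjI ballI)
    show "openin (Euclidean_space m) V" using f by (simp add: smooth_euclidean_def)
    fix v assume v: "v \<in> V"
    then have "f v \<in> U" using f by (auto simp: smooth_euclidean_def)
    then obtain W where W: "openin (Euclidean_space n) W" "f v \<in> W" "B n W p"
      using p unfolding locally_on_def by blast
    show "\<exists>W. openin (Euclidean_space m) W \<and> v \<in> W \<and> W \<subseteq> V \<and> B m W (p \<circ> f)"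
      using smooth_euclidean_openin_vimage[OF f W(1)] v W(2)
        comp[OF smooth_euclidean_restrict[OF f W(1)] W(3)]
      by (intro exI[of _ "V \<inter> f -` W"]) simp
  qed
  show "locally_on n U (\<lambda>V. B n V p)"
    if "locally_on n U (\<lambda>V. locally_on n V (\<lambda>V. B n V p))" for n U p
    using that by (rule locally_on_idem)
qed

lemma is_diffeologyD:
  assumes "is_diffeology D"
  shows is_diffeology_openin: "D n U p \<Longrightarrow> openin (Euclidean_space n) U"
    and is_diffeology_cong: "D n U p \<Longrightarrow> (\<And>u. u \<in> U \<Longrightarrow> p u = q u) \<Longrightarrow> D n U q"
    and is_diffeology_const: "openin (Euclidean_space n) U \<Longrightarrow> D n U (\<lambda>_. a)"
    and is_diffeology_compose: "smooth_euclidean m V n U f \<Longrightarrow> D n U p \<Longrightarrow> D m V (p \<circ> f)"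
    and is_diffeology_local: "locally_on n U (\<lambda>V. D n V p) \<Longrightarrow> D n U p"
proof -
  note D = assms[unfolded is_diffeology_def]
  note 1 = D[THEN conjunct1] D[THEN conjunct2, THEN conjunct1]
    D[THEN conjunct2, THEN conjunct2, THEN conjunct1]
    D[THEN conjunct2, THEN conjunct2, THEN conjunct2, THEN conjunct1]
    D[THEN conjunct2, THEN conjunct2, THEN conjunct2, THEN conjunct2]
  show "D n U p \<Longrightarrow> openin (Euclidean_space n) U" by (rule 1(1)[rule_format])
  show "D n U p \<Longrightarrow> (\<And>u. u \<in> U \<Longrightarrow> p u = q u) \<Longrightarrow> D n U q" by (rule 1(2)[rule_format])
  show "openin (Euclidean_space n) U \<Longrightarrow> D n U (\<lambda>_. a)" by (rule 1(3)[rule_format])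
  show "smooth_euclidean m V n U f \<Longrightarrow> D n U p \<Longrightarrow> D m V (p \<circ> f)" by (rule 1(4)[rule_format])
  show "locally_on n U (\<lambda>V. D n V p) \<Longrightarrow> D n U p" by (rule 1(5)[rule_format])
qed

lemma is_diffeology_subset:
  assumes D: "is_diffeology D" "D n U p" and V: "openin (Euclidean_space n) V" "V \<subseteq> U"
  shows "D n V p"
proof -
  have "D n V (p \<circ> id)"
    using smooth_euclidean_inclusion[OF V(1) is_diffeology_openin[OF D(1), OF D(2)] V(2)] D(2)
    by (rule is_diffeology_compose[OF D(1)])
  then show ?thesis by simp
qed

lemma is_diffeology_real: "is_diffeology real_diffeology"
  unfolding is_diffeology_def real_diffeology_def
proof (intro conjI allI impI)
  show "smooth_real_on n U q" if "smooth_real_on n U p" "\<forall>u\<in>U. p u = q u" for n U p q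
    using that(1) by (rule smooth_real_on_cong) (use that(2) in simp)
qed (simp_all add: smooth_real_on_openin smooth_real_on_const smooth_real_on_compose smooth_real_on_local)

lemma is_diffeology_coprod:
  assumes "\<And>i. is_diffeology (D i)"
  shows "is_diffeology (coprod_diffeology D)"
proof -
  have "is_diffeology (\<lambda>n U p. locally_on n U (\<lambda>V. \<exists>i q. D i n V q \<and> (\<forall>v\<in>V. p v = (i, q v))))"
  proof (rule is_diffeology_locally)
    show "\<exists>i q. D i n U q \<and> (\<forall>v\<in>U. a = (i, q v))" if "openin (Euclidean_space n) U" for n U a
      using is_diffeology_const[OF assms, OF that]
      by (intro exI[of _ "fst a"] exI[of _ "\<lambda>_. snd a"]) simp
    show "\<exists>i q. D i m V q \<and> (\<forall>v\<in>V. (p \<circ> f) v = (i, q v))"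
      if f: "smooth_euclidean m V n U f" and p: "\<exists>i q. D i n U q \<and> (\<forall>v\<in>U. p v = (i, q v))"
      for m V n U f p
    proof -
      obtain i q where iq: "D i n U q" "\<forall>v\<in>U. p v = (i, q v)" using p by blast
      have "D i m V (q \<circ> f)" using is_diffeology_compose[OF assms, OF f iq(1)] .
      moreover have "f ` V \<subseteq> U" using f by (simp add: smooth_euclidean_def)
      ultimately show ?thesis using iq(2) by (intro exI[of _ i] exI[of _ "q \<circ> f"]) auto
    qed
  qed auto
  then show ?thesis unfolding coprod_diffeology_def[abs_def] .
qed

text \<open>Surjectivity serves the constant plots, whose value needs a preimage; the other plots
  bring their local lifts with them.\<close>

lemma is_diffeology_quotient:
  assumes "is_diffeology D" "surj \<pi>"
  shows "is_diffeology (quotient_diffeology \<pi> D)"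
proof -
  have "is_diffeology (\<lambda>n U p. locally_on n U (\<lambda>V. \<exists>q. D n V q \<and> (\<forall>v\<in>V. p v = \<pi> (q v))))"
  proof (rule is_diffeology_locally)
    show "\<exists>q. D n U q \<and> (\<forall>v\<in>U. a = \<pi> (q v))" if "openin (Euclidean_space n) U" for n U a
    proof -
      obtain b where "a = \<pi> b" using assms(2) by blast
      then show ?thesis using is_diffeology_const[OF assms(1), OF that] by (intro exI[of _ "\<lambda>_. b"]) simp
    qed
    show "\<exists>q. D m V q \<and> (\<forall>v\<in>V. (p \<circ> f) v = \<pi> (q v))"
      if f: "smooth_euclidean m V n U f" and p: "\<exists>q. D n U q \<and> (\<forall>v\<in>U. p v = \<pi> (q v))"
      for m V n U f p
    proof -
      obtain q where q: "D n U q" "\<forall>v\<in>U. p v = \<pi> (q v)" using p by blast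
      have "D m V (q \<circ> f)" using is_diffeology_compose[OF assms(1), OF f q(1)] .
      moreover have "f ` V \<subseteq> U" using f by (simp add: smooth_euclidean_def)
      ultimately show ?thesis using q(2) by (intro exI[of _ "q \<circ> f"]) auto
    qed
  qed auto
  then show ?thesis unfolding quotient_diffeology_def[abs_def] .
qed

lemma surj_abs_wedge: "surj abs_wedge"
  using Quotient3_wedge by (metis Quotient3_abs_rep surjI)

lemma is_diffeology_wedge: "is_diffeology wedge_diffeology"
  unfolding wedge_diffeology_def
  by (intro is_diffeology_quotient is_diffeology_coprod is_diffeology_real surj_abs_wedge)

section \<open>The free diffeological vector space\<close>

lemma lookup_scaleR: "Poly_Mapping.lookup (r *\<^sub>R v) x = r *\<^sub>R Poly_Mapping.lookup v x"
  by transfer simp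

lemma poly_mapping_eq_sum_single:
  fixes v :: "'x \<Rightarrow>\<^sub>0 real"
  shows "v = (\<Sum>x\<in>Poly_Mapping.keys v. Poly_Mapping.lookup v x *\<^sub>R Poly_Mapping.single x 1)"
proof (rule poly_mapping_eqI)
  fix y
  have "(\<Sum>x\<in>Poly_Mapping.keys v. Poly_Mapping.lookup v x * (1 when x = y)) =
      (\<Sum>x\<in>Poly_Mapping.keys v. if y = x then Poly_Mapping.lookup v x else 0)"
    by (intro sum.cong) (auto simp: when_def)
  also have "\<dots> = Poly_Mapping.lookup v y"
    by (simp add: sum.delta in_keys_iff)
  finally show "Poly_Mapping.lookup v y = Poly_Mapping.lookup
      (\<Sum>x\<in>Poly_Mapping.keys v. Poly_Mapping.lookup v x *\<^sub>R Poly_Mapping.single x 1) y"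
    by (simp add: lookup_sum lookup_scaleR lookup_single)
qed

text \<open>The local form hidden inside \<open>free_diffeology\<close>, named so that
  \<open>is_diffeology_locally\<close> can be applied to it.\<close>

definition free_combination ::
  "'x diffeology \<Rightarrow> nat \<Rightarrow> (nat \<Rightarrow> real) set \<Rightarrow> ((nat \<Rightarrow> real) \<Rightarrow> 'x \<Rightarrow>\<^sub>0 real) \<Rightarrow> bool" where
  "free_combination X n V p \<longleftrightarrow> (\<exists>k r q. (\<forall>i<k. smooth_real_on n V (r i) \<and> X n V (q i)) \<and>
     (\<forall>v\<in>V. p v = (\<Sum>i<k::nat. r i v *\<^sub>R Poly_Mapping.single (q i v) 1)))"

lemma free_diffeology_eq: "free_diffeology X n U p \<longleftrightarrow> locally_on n U (\<lambda>V. free_combination X n V p)"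
  by (simp add: free_diffeology_def free_combination_def)

lemma free_combinationI:
  fixes k :: nat
  assumes "\<And>i. i < k \<Longrightarrow> smooth_real_on n V (r i)" "\<And>i. i < k \<Longrightarrow> X n V (q i)"
    and "\<And>v. v \<in> V \<Longrightarrow> p v = (\<Sum>i<k. r i v *\<^sub>R Poly_Mapping.single (q i v) 1)"
  shows "free_combination X n V p"
  using assms unfolding free_combination_def by blast

lemma free_combinationE:
  assumes "free_combination X n V p"
  obtains k :: nat and r q where "\<forall>i<k. smooth_real_on n V (r i)" "\<forall>i<k. X n V (q i)"
    "\<forall>v\<in>V. p v = (\<Sum>i<k. r i v *\<^sub>R Poly_Mapping.single (q i v) 1)"
proof -
  obtain k :: nat and r q where "\<forall>i<k. smooth_real_on n V (r i) \<and> X n V (q i)"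
    "\<forall>v\<in>V. p v = (\<Sum>i<k. r i v *\<^sub>R Poly_Mapping.single (q i v) 1)"
    using assms unfolding free_combination_def by (elim exE conjE) (rule that)
  then show ?thesis by (intro that[of k r q]) simp_all
qed

text \<open>A fixed vector is its own finite expansion in the basis; \<open>h\<close> numbers its
  support by the indices below the cardinality.\<close>

lemma free_combination_const:
  assumes X: "is_diffeology X" and V: "openin (Euclidean_space n) V"
  shows "free_combination X n V (\<lambda>_. a)"
proof -
  obtain h where h: "bij_betw h {0..<card (Poly_Mapping.keys a)} (Poly_Mapping.keys a)"
    using ex_bij_betw_nat_finite[OF finite_keys] by blast
  show ?thesis
  proof (rule free_combinationI)
    show "a = (\<Sum>i<card (Poly_Mapping.keys a).
        Poly_Mapping.lookup a (h i) *\<^sub>R Poly_Mapping.single (h i) 1)"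
      using sum.reindex_bij_betw[OF h, of "\<lambda>x. Poly_Mapping.lookup a x *\<^sub>R Poly_Mapping.single x (1 :: real)"]
        poly_mapping_eq_sum_single[of a] by (simp add: atLeast0LessThan)
  qed (use smooth_real_on_const[OF V] is_diffeology_const[OF X, OF V] in auto)
qed

lemma free_combination_compose:
  assumes X: "is_diffeology X" and f: "smooth_euclidean m V n U f" and p: "free_combination X n U p"
  shows "free_combination X m V (p \<circ> f)"
proof -
  obtain k :: nat and r q where *: "\<forall>i<k. smooth_real_on n U (r i)" "\<forall>i<k. X n U (q i)"
    "\<forall>v\<in>U. p v = (\<Sum>i<k. r i v *\<^sub>R Poly_Mapping.single (q i v) 1)"
    by (rule free_combinationE[OF p]) (rule that, assumption+)
  show ?thesis
  proof (rule free_combinationI)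
    show "smooth_real_on m V (r i \<circ> f)" if "i < k" for i
      using smooth_real_on_compose[OF f] *(1) that by blast
    show "X m V (q i \<circ> f)" if "i < k" for i
      using is_diffeology_compose[OF X, OF f] *(2) that by blast
    show "(p \<circ> f) v = (\<Sum>i<k. (r i \<circ> f) v *\<^sub>R Poly_Mapping.single ((q i \<circ> f) v) 1)" if "v \<in> V" for v
      using *(3) f that by (auto simp: smooth_euclidean_def image_subset_iff)
  qed
qed

lemma free_combination_subset:
  assumes "is_diffeology X" "free_combination X n U p" "openin (Euclidean_space n) U"
    "openin (Euclidean_space n) V" "V \<subseteq> U"
  shows "free_combination X n V p"
  using free_combination_compose[OF assms(1) smooth_euclidean_inclusion[OF assms(4,3,5)] assms(2)]
  by simp

lemma is_diffeology_free:
  assumes X: "is_diffeology X"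
  shows "is_diffeology (free_diffeology X)"
proof -
  have "is_diffeology (\<lambda>n U p. locally_on n U (\<lambda>V. free_combination X n V p))"
  proof (rule is_diffeology_locally)
    show "free_combination X n U q" if "free_combination X n U p" "\<forall>u\<in>U. p u = q u" for n U p q
      using that unfolding free_combination_def by simp
    show "free_combination X n U (\<lambda>_. a)" if "openin (Euclidean_space n) U" for n U a
      using X that by (rule free_combination_const)
    show "free_combination X m V (p \<circ> f)"
      if "smooth_euclidean m V n U f" "free_combination X n U p" for m V n U f p
      using X that by (rule free_combination_compose)
  qed
  then show ?thesis unfolding free_diffeology_eq[abs_def] .
qed

lemma free_combination_add:
  assumes "free_combination X n V p" "free_combination X n V p'"
  shows "free_combination X n V (\<lambda>v. p v + p' v)"
proof -
  obtain k :: nat and r q where *: "\<forall>i<k. smooth_real_on n V (r i)" "\<forall>i<k. X n V (q i)"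
    "\<forall>v\<in>V. p v = (\<Sum>i<k. r i v *\<^sub>R Poly_Mapping.single (q i v) 1)"
    by (rule free_combinationE[OF assms(1)]) (rule that, assumption+)
  obtain k' :: nat and r' q' where **: "\<forall>i<k'. smooth_real_on n V (r' i)" "\<forall>i<k'. X n V (q' i)"
    "\<forall>v\<in>V. p' v = (\<Sum>i<k'. r' i v *\<^sub>R Poly_Mapping.single (q' i v) 1)"
    by (rule free_combinationE[OF assms(2)]) (rule that, assumption+)
  define R where "R i = (if i < k then r i else r' (i - k))" for i
  define Q where "Q i = (if i < k then q i else q' (i - k))" for i
  have "(\<Sum>i<k + k'. R i v *\<^sub>R Poly_Mapping.single (Q i v) 1) =
      (\<Sum>i<k. r i v *\<^sub>R Poly_Mapping.single (q i v) (1 :: real)) +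
      (\<Sum>i<k'. r' i v *\<^sub>R Poly_Mapping.single (q' i v) 1)" for v
  proof -
    have "(\<Sum>i<k + k'. R i v *\<^sub>R Poly_Mapping.single (Q i v) (1 :: real)) =
        (\<Sum>i<k. R i v *\<^sub>R Poly_Mapping.single (Q i v) 1) +
        (\<Sum>i<k'. R (k + i) v *\<^sub>R Poly_Mapping.single (Q (k + i) v) 1)"
      by (induction k') (simp_all add: add.assoc)
    then show ?thesis by (simp add: R_def Q_def)
  qed
  with * ** show ?thesis
    by (intro free_combinationI[of "k + k'" n V R X Q]) (simp_all add: R_def Q_def)
qed

lemma free_combination_scaleR:
  assumes "smooth_real_on n V s" "free_combination X n V p"
  shows "free_combination X n V (\<lambda>v. s v *\<^sub>R p v)"
proof -
  obtain k :: nat and r q where *: "\<forall>i<k. smooth_real_on n V (r i)" "\<forall>i<k. X n V (q i)"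
    "\<forall>v\<in>V. p v = (\<Sum>i<k. r i v *\<^sub>R Poly_Mapping.single (q i v) 1)"
    by (rule free_combinationE[OF assms(2)]) (rule that, assumption+)
  then show ?thesis using smooth_real_on_mult[OF assms(1)]
    by (intro free_combinationI[of k n V "\<lambda>i v. s v * r i v" X q]) (simp_all add: scaleR_sum_right)
qed

lemma diffeological_vector_space_free:
  assumes X: "is_diffeology X"
  shows "diffeological_vector_space (free_diffeology X)"
proof -
  have D: "is_diffeology (free_diffeology X)" using is_diffeology_free[OF X] .
  \<comment> \<open>Restriction is composition with an inclusion, which is smooth only between open
    sets. Openness of \<open>V\<close> is therefore carried along in the local condition.\<close>
  have restrict: "free_combination X n W p"
    if "openin (Euclidean_space n) V \<and> free_combination X n V p" "openin (Euclidean_space n) W" "W \<subseteq> V"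
    for n V W p
    using free_combination_subset[OF X] that by blast
  have loc: "locally_on n U (\<lambda>V. openin (Euclidean_space n) V \<and> free_combination X n V p)"
    if "free_diffeology X n U p" for n U p
    using that unfolding free_diffeology_eq by (rule locally_on_mono) simp
  have "free_diffeology X n U (\<lambda>u. p u + q u)"
    if "free_diffeology X n U p" "free_diffeology X n U q" for n U p q
  proof -
    have "locally_on n U (\<lambda>V. (openin (Euclidean_space n) V \<and> free_combination X n V p) \<and>
        (openin (Euclidean_space n) V \<and> free_combination X n V q))"
      by (rule locally_on_conj[OF loc[OF that(1)] loc[OF that(2)]]) (use restrict in auto)
    then show ?thesis unfolding free_diffeology_eq
      by (rule locally_on_mono) (simp add: free_combination_add)
  qed
  moreover have "free_diffeology X n U (\<lambda>u. r u *\<^sub>R p u)"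
    if r: "smooth_real_on n U r" and p: "free_diffeology X n U p" for n U r p
    using loc[OF p] unfolding free_diffeology_eq
  proof (rule locally_on_mono)
    fix V assume V: "openin (Euclidean_space n) V" "V \<subseteq> U"
      "openin (Euclidean_space n) V \<and> free_combination X n V p"
    have "smooth_real_on n V r"
      using is_diffeology_subset[OF is_diffeology_real, OF _ V(1,2)] r by (simp add: real_diffeology_def)
    then show "free_combination X n V (\<lambda>u. r u *\<^sub>R p u)"
      using V(3) free_combination_scaleR by blast
  qed
  ultimately show ?thesis using D
    unfolding diffeological_vector_space_def smooth_map_def prod_diffeology_def real_diffeology_def
    by (auto simp: comp_def case_prod_unfold)
qed

lemma dvs_is_diffeology: "diffeological_vector_space D \<Longrightarrow> is_diffeology D"
  by (simp add: diffeological_vector_space_def)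

lemma smooth_mapD: "smooth_map D E f \<Longrightarrow> D n U p \<Longrightarrow> E n U (f \<circ> p)"
  unfolding smooth_map_def by simp

lemma dvs_plot_add:
  assumes "diffeological_vector_space D" "D n U p" "D n U q"
  shows "D n U (\<lambda>u. p u + q u)"
proof -
  have "prod_diffeology D D n U (\<lambda>u. (p u, q u))"
    using assms(2,3) by (simp add: prod_diffeology_def comp_def)
  moreover have "smooth_map (prod_diffeology D D) D (\<lambda>(x, y). x + y)"
    using assms(1) by (simp add: diffeological_vector_space_def)
  ultimately have "D n U ((\<lambda>(x, y). x + y) \<circ> (\<lambda>u. (p u, q u)))"
    by (rule smooth_mapD[rotated])
  then show ?thesis by (simp add: comp_def)
qed

lemma dvs_plot_scaleR:
  assumes "diffeological_vector_space D" "smooth_real_on n U r" "D n U p"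
  shows "D n U (\<lambda>u. r u *\<^sub>R p u)"
proof -
  have "prod_diffeology real_diffeology D n U (\<lambda>u. (r u, p u))"
    using assms(2,3) by (simp add: prod_diffeology_def comp_def real_diffeology_def)
  moreover have "smooth_map (prod_diffeology real_diffeology D) D (\<lambda>(r, x). r *\<^sub>R x)"
    using assms(1) by (simp add: diffeological_vector_space_def)
  ultimately have "D n U ((\<lambda>(r, x). r *\<^sub>R x) \<circ> (\<lambda>u. (r u, p u)))"
    by (rule smooth_mapD[rotated])
  then show ?thesis by (simp add: comp_def)
qed

lemma dvs_plot_sum:
  assumes D: "diffeological_vector_space D" and U: "openin (Euclidean_space n) U"
    and p: "\<And>j. j \<in> J \<Longrightarrow> D n U (p j)"
  shows "D n U (\<lambda>u. \<Sum>j\<in>J. p j u)"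
  using p
proof (induction J rule: infinite_finite_induct)
  case (insert j J)
  then have "D n U (\<lambda>u. p j u + (\<Sum>j\<in>J. p j u))" by (intro dvs_plot_add[OF D]) simp_all
  then show ?case using insert.hyps by simp
qed (simp_all add: is_diffeology_const[OF dvs_is_diffeology[OF D], OF U])

section \<open>Projectivity\<close>

definition line_point :: "real \<Rightarrow> nat \<Rightarrow> real" where
  "line_point t = (\<lambda>i. if i = 0 then t else 0)"

definition line_interval :: "real \<Rightarrow> real \<Rightarrow> (nat \<Rightarrow> real) set" where
  "line_interval a b = {x \<in> topspace (Euclidean_space 1). a < x 0 \<and> x 0 < b}"

lemma line_point_in_topspace: "line_point t \<in> topspace (Euclidean_space 1)"
  by (simp add: line_point_def topspace_Euclidean_space)

lemma line_point_0 [simp]: "line_point t 0 = t"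
  by (simp add: line_point_def)

lemma openin_line_interval: "openin (Euclidean_space 1) (line_interval a b)"
proof -
  have "open {x :: nat \<Rightarrow> real. a < x 0 \<and> x 0 < b}"
    by (intro open_Collect_conj open_Collect_less continuous_on_const continuous_on_product_coordinates)
  moreover have "line_interval a b = {x. \<forall>i\<ge>1. x i = 0} \<inter> {x. a < x 0 \<and> x 0 < b}"
    by (auto simp: line_interval_def topspace_Euclidean_space)
  ultimately show ?thesis unfolding Euclidean_space_eq_top_of_set openin_open by blast
qed

lemma line_interval_neighbourhood:
  assumes "openin (Euclidean_space 1) V" "u \<in> V"
  obtains d where "d > 0" "line_interval (u 0 - d) (u 0 + d) \<subseteq> V"
proof -
  obtain e where e: "e > 0"
    "\<And>y. \<forall>i\<ge>1. y i = 0 \<Longrightarrow> \<forall>i<1. \<bar>y i - u i\<bar> < e \<Longrightarrow> y \<in> V"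
    using openin_Euclidean_space_box[OF assms] by metis
  have "line_interval (u 0 - e) (u 0 + e) \<subseteq> V"
  proof
    fix y assume "y \<in> line_interval (u 0 - e) (u 0 + e)"
    then show "y \<in> V" by (intro e(2)) (auto simp: line_interval_def topspace_Euclidean_space)
  qed
  then show ?thesis using e(1) that by blast
qed

text \<open>\<open>local_lift\<close> is exactly what it means for \<gamma> to be a plot of the
  quotient diffeology defined on the whole line.\<close>

locale line_lifting =
  fixes D :: "'v::real_vector diffeology" and \<pi> :: "'v \<Rightarrow> 'w::real_vector"
    and \<gamma> :: "(nat \<Rightarrow> real) \<Rightarrow> 'w"
  assumes dvs: "diffeological_vector_space D" and linear: "linear \<pi>"
    and local_lift: "locally_on 1 (topspace (Euclidean_space 1))
      (\<lambda>V. \<exists>q. D 1 V q \<and> (\<forall>v\<in>V. \<gamma> v = \<pi> (q v)))"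
begin

definition lifts :: "real \<Rightarrow> real \<Rightarrow> ((nat \<Rightarrow> real) \<Rightarrow> 'v) \<Rightarrow> bool" where
  "lifts a b h \<longleftrightarrow> D 1 (line_interval a b) h \<and> (\<forall>u\<in>line_interval a b. \<pi> (h u) = \<gamma> u)"

lemma lifts_subset:
  assumes "lifts a b h" "a \<le> a'" "b' \<le> b"
  shows "lifts a' b' h"
proof -
  have sub: "line_interval a' b' \<subseteq> line_interval a b"
    using assms(2,3) by (auto simp: line_interval_def)
  have "D 1 (line_interval a' b') h"
    using assms(1) unfolding lifts_def
    by (intro is_diffeology_subset[OF dvs_is_diffeology[OF dvs], OF _ openin_line_interval sub]) simp
  then show ?thesis using assms(1) sub unfolding lifts_def by blast
qed

lemma lifts_cong:
  assumes "lifts a b h" "\<And>u. u \<in> line_interval a b \<Longrightarrow> h u = h' u"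
  shows "lifts a b h'"
proof -
  have "D 1 (line_interval a b) h'"
    using assms is_diffeology_cong[OF dvs_is_diffeology[OF dvs], of 1 "line_interval a b" h h']
    unfolding lifts_def by simp
  then show ?thesis using assms unfolding lifts_def by simp
qed

text \<open>The difference of two lifts lies in the kernel of \<pi> pointwise, so adding any smooth
  multiple of it to a lift gives a lift again.\<close>

lemma lifts_interpolate:
  assumes "lifts a b h" "lifts a b h'"
  shows "lifts a b (\<lambda>u. h u + smooth_step (c * u 0 + d) *\<^sub>R (h' u - h u))"
proof -
  let ?I = "line_interval a b"
  have h: "D 1 ?I h" "D 1 ?I h'" using assms by (simp_all add: lifts_def)
  have "D 1 ?I (\<lambda>u. h' u + (-1) *\<^sub>R h u)"
    by (rule dvs_plot_add[OF dvs, OF h(2) dvs_plot_scaleR[OF dvs, OF smooth_real_on_const[OF openin_line_interval] h(1)]])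
  then have "D 1 ?I (\<lambda>u. h u + smooth_step (c * u 0 + d) *\<^sub>R (h' u - h u))"
    using dvs_plot_add[OF dvs, OF h(1) dvs_plot_scaleR[OF dvs, OF smooth_real_on_step[OF openin_line_interval]]]
    by simp
  then show ?thesis
    using assms linear by (simp add: lifts_def linear_add linear_scale linear_diff)
qed

lemma lifts_local:
  assumes "\<And>u. u \<in> line_interval a b \<Longrightarrow>
    \<exists>c d. c < u 0 \<and> u 0 < d \<and> a \<le> c \<and> d \<le> b \<and> lifts c d h"
  shows "lifts a b h"
proof -
  have "locally_on 1 (line_interval a b) (\<lambda>V. D 1 V h \<and> (\<forall>u\<in>V. \<pi> (h u) = \<gamma> u))"
    unfolding locally_on_def
  proof (intro conjI ballI openin_line_interval)
    fix u assume u: "u \<in> line_interval a b"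
    then obtain c d where cd: "c < u 0" "u 0 < d" "a \<le> c" "d \<le> b" "lifts c d h"
      using assms by blast
    show "\<exists>V. openin (Euclidean_space 1) V \<and> u \<in> V \<and> V \<subseteq> line_interval a b \<and>
        D 1 V h \<and> (\<forall>u\<in>V. \<pi> (h u) = \<gamma> u)"
      using cd u openin_line_interval
      by (intro exI[of _ "line_interval c d"]) (auto simp: lifts_def line_interval_def)
  qed
  then have loc: "locally_on 1 (line_interval a b) (\<lambda>V. D 1 V h)"
    and "\<forall>u\<in>line_interval a b. \<pi> (h u) = \<gamma> u"
    unfolding locally_on_def by blast+
  then show ?thesis
    using is_diffeology_local[OF dvs_is_diffeology[OF dvs], OF loc] unfolding lifts_def by simp
qed

text \<open>Bolzano's principle replaces a compactness argument: local existence plus concatenation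
  of adjacent intervals. The margin \<open>e\<close> around the closed interval is what makes
  adjacent lifts overlap and leaves room for blending them.\<close>

lemma ex_lifts_interval:
  assumes "a \<le> b"
  shows "\<exists>e>0. \<exists>h. lifts (a - e) (b + e) h"
  using assms
proof (induction rule: Bolzano)
  case (trans a b c)
  obtain e\<^sub>1 h\<^sub>1 where 1: "e\<^sub>1 > 0" "lifts (a - e\<^sub>1) (b + e\<^sub>1) h\<^sub>1" using trans by blast
  obtain e\<^sub>2 h\<^sub>2 where 2: "e\<^sub>2 > 0" "lifts (b - e\<^sub>2) (c + e\<^sub>2) h\<^sub>2" using trans by blast
  define e where "e = min e\<^sub>1 e\<^sub>2"
  have e: "e > 0" "e \<le> e\<^sub>1" "e \<le> e\<^sub>2" using 1(1) 2(1) by (auto simp: e_def)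
  have h1: "lifts (a - e) (b + e) h\<^sub>1" using lifts_subset[OF 1(2)] e by simp
  have h2: "lifts (b - e) (c + e) h\<^sub>2" using lifts_subset[OF 2(2)] e by simp
  \<comment> \<open>The transition takes place over the middle half of the overlap from
    \<open>b - e\<close> to \<open>b + e\<close>, where both lifts are defined.\<close>
  define h where "h u = (if u 0 \<le> b - e / 2 then h\<^sub>1 u else if u 0 \<ge> b + e / 2 then h\<^sub>2 u
    else h\<^sub>1 u + smooth_step (1 / e * u 0 + (1 / 2 - b / e)) *\<^sub>R (h\<^sub>2 u - h\<^sub>1 u))" for u
  \<comment> \<open>The argument of the step rises from 0 at \<open>b - e / 2\<close> to 1 at
    \<open>b + e / 2\<close>; \<open>arg'\<close> displays the second of these facts.\<close>
  have arg: "1 / e * t + (1 / 2 - b / e) = (t - (b - e / 2)) / e" for t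
    using e(1) by (simp add: field_simps)
  have arg': "(t - (b - e / 2)) / e = (t - (b + e / 2)) / e + 1" for t
    using e(1) by (simp add: field_simps)
  have "lifts (a - e) (c + e) h"
  proof (rule lifts_local)
    fix u assume u: "u \<in> line_interval (a - e) (c + e)"
    \<comment> \<open>These open regions cover the interval. On the third one \<open>h\<close>
      equals the blend throughout, since the step is constant where the definition of
      \<open>h\<close> switches to \<open>h\<^sub>1\<close> or \<open>h\<^sub>2\<close>.\<close>
    consider "u 0 < b - e / 2" | "u 0 > b + e / 2" | "b - e < u 0" "u 0 < b + e"
      using e(1) by fastforce
    then show "\<exists>c' d. c' < u 0 \<and> u 0 < d \<and> a - e \<le> c' \<and> d \<le> c + e \<and> lifts c' d h"
    proof cases
      case 1
      have "lifts (a - e) (b - e / 2) h"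
        by (rule lifts_cong[OF lifts_subset[OF h1]]) (use e(1) in \<open>auto simp: h_def line_interval_def\<close>)
      then show ?thesis using 1 u trans(3,4) e(1)
        by (intro exI[of _ "a - e"] exI[of _ "b - e / 2"]) (auto simp: line_interval_def)
    next
      case 2
      have "lifts (b + e / 2) (c + e) h"
        by (rule lifts_cong[OF lifts_subset[OF h2]]) (use e(1) in \<open>auto simp: h_def line_interval_def\<close>)
      then show ?thesis using 2 u trans(3,4) e(1)
        by (intro exI[of _ "b + e / 2"] exI[of _ "c + e"]) (auto simp: line_interval_def)
    next
      case 3
      have "lifts (b - e) (b + e) (\<lambda>u. h\<^sub>1 u + smooth_step (1 / e * u 0 + (1 / 2 - b / e)) *\<^sub>R (h\<^sub>2 u - h\<^sub>1 u))"
        by (intro lifts_interpolate lifts_subset[OF h1] lifts_subset[OF h2]) (use trans(3,4) in auto)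
      then have "lifts (b - e) (b + e) h"
      proof (rule lifts_cong)
        fix v :: "nat \<Rightarrow> real"
        have "smooth_step ((v 0 - (b - e / 2)) / e) = 0" if "v 0 \<le> b - e / 2"
          using that e(1) by (intro smooth_step_eq_0) (simp add: divide_nonpos_pos)
        moreover have "smooth_step ((v 0 - (b - e / 2)) / e) = 1" if "v 0 \<ge> b + e / 2"
          unfolding arg' using that e(1) by (intro smooth_step_eq_1) simp
        ultimately show "h\<^sub>1 v + smooth_step (1 / e * v 0 + (1 / 2 - b / e)) *\<^sub>R (h\<^sub>2 v - h\<^sub>1 v) = h v"
          unfolding h_def arg by simp
      qed
      then show ?thesis using 3 trans(3,4)
        by (intro exI[of _ "b - e"] exI[of _ "b + e"]) auto
    qed
  qed
  then show ?case using e(1) by blast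
next
  case (local x)
  obtain V q where V: "openin (Euclidean_space 1) V" "line_point x \<in> V" "D 1 V q"
    "\<forall>v\<in>V. \<gamma> v = \<pi> (q v)"
    using local_lift line_point_in_topspace unfolding locally_on_def by blast
  obtain d where d: "d > 0" "line_interval (x - d) (x + d) \<subseteq> V"
    using line_interval_neighbourhood[OF V(1,2)] by auto
  have "D 1 (line_interval (x - d) (x + d)) q"
    using is_diffeology_subset[OF dvs_is_diffeology[OF dvs], OF V(3) openin_line_interval d(2)] .
  then have q: "lifts (x - d) (x + d) q"
    using V(4) d(2) by (auto simp: lifts_def)
  show ?case
  \<comment> \<open>Half of \<open>d\<close> bounds the length of the interval around
    \<open>x\<close> and the other half is its margin; together they stay within distance
    \<open>d\<close> of \<open>x\<close>.\<close>
  proof (rule exI[of _ "d / 2"], intro conjI allI impI)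
    fix a b assume "a \<le> x \<and> x \<le> b \<and> b - a < d / 2"
    then have "lifts (a - d / 2) (b + d / 2) q" by (intro lifts_subset[OF q]) auto
    then show "\<exists>e>0. \<exists>h. lifts (a - e) (b + e) h" using d(1) half_gt_zero by blast
  qed (use d(1) in simp)
qed

text \<open>Bounded intervals do not exhaust the line in one step. Choosing one lift for each
  integer m over (m, m + 2) and blending only neighbours avoids any recursion, since each point is
  affected by two of the chosen lifts.\<close>

lemma ex_global_lift:
  "\<exists>h. D 1 (topspace (Euclidean_space 1)) h \<and> (\<forall>u\<in>topspace (Euclidean_space 1). \<pi> (h u) = \<gamma> u)"
proof -
  have "\<exists>h. lifts (of_int m) (of_int m + 2) h" for m :: int
  proof -
    obtain e h where "e > 0" "lifts (of_int m - e) (of_int m + 2 + e) h"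
      using ex_lifts_interval[of "of_int m" "of_int m + 2"] by auto
    then have "lifts (of_int m) (of_int m + 2) h"
      using lifts_subset[of "of_int m - e" "of_int m + 2 + e" h "of_int m" "of_int m + 2"] by simp
    then show ?thesis by blast
  qed
  then have "\<forall>m :: int. \<exists>h. lifts (of_int m) (of_int m + 2) h" by blast
  from choice[OF this] obtain k where k: "\<And>m :: int. lifts (of_int m) (of_int m + 2) (k m)" by blast
  (* k (m - 1) and k m are both defined on the interval (m, m + 1); moving from the first to the
     second within its middle third leaves only k (m - 1) near the integer m. *)
  define h where "h u = (let m = \<lfloor>u 0\<rfloor> in k (m - 1) u +
    smooth_step (3 * u 0 + (- 3 * of_int m - 1)) *\<^sub>R (k m u - k (m - 1) u))" for u :: "nat \<Rightarrow> real"
  have cover: "\<exists>c d. c < u 0 \<and> u 0 < d \<and> lifts c d h" for u :: "nat \<Rightarrow> real"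
  proof -
    define m where "m = \<lfloor>u 0\<rfloor>"
    have m: "of_int m \<le> u 0" "u 0 < of_int m + 1" unfolding m_def by linarith+
    have km: "lifts (of_int m - 1) (of_int m + 1) (k (m - 1))" using k[of "m - 1"] by (simp add: add.commute)
    show ?thesis
    proof (cases "of_int m < u 0")
      case True
      have "lifts (of_int m) (of_int m + 1) (\<lambda>u. k (m - 1) u +
          smooth_step (3 * u 0 + (- 3 * of_int m - 1)) *\<^sub>R (k m u - k (m - 1) u))"
        by (intro lifts_interpolate lifts_subset[OF km] lifts_subset[OF k[of m]]) auto
      then have "lifts (of_int m) (of_int m + 1) h"
      proof (rule lifts_cong)
        fix v assume "v \<in> line_interval (of_int m) (of_int m + 1)"
        then have "\<lfloor>v 0\<rfloor> = m" by (intro floor_unique) (auto simp: line_interval_def)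
        then show "k (m - 1) v + smooth_step (3 * v 0 + (- 3 * of_int m - 1)) *\<^sub>R (k m v - k (m - 1) v) = h v"
          by (simp add: h_def)
      qed
      then show ?thesis using True m(2) by blast
    next
      case False
      have "lifts (of_int m - 1 / 3) (of_int m + 1 / 3) (k (m - 1))"
        by (intro lifts_subset[OF km]) auto
      then have "lifts (of_int m - 1 / 3) (of_int m + 1 / 3) h"
      proof (rule lifts_cong)
        fix v assume "v \<in> line_interval (of_int m - 1 / 3) (of_int m + 1 / 3)"
        then have v: "of_int m - 1 / 3 < v 0" "v 0 < of_int m + 1 / 3" by (auto simp: line_interval_def)
        show "k (m - 1) v = h v"
        proof (cases "of_int m \<le> v 0")
          case True
          then have "\<lfloor>v 0\<rfloor> = m" using v by (intro floor_unique) auto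
          moreover have "smooth_step (3 * v 0 + (- 3 * of_int m - 1)) = 0" using v by (intro smooth_step_eq_0) simp
          ultimately show ?thesis by (simp add: h_def)
        next
          case False
          \<comment> \<open>Left of m the floor drops, and \<open>h\<close> blends
            \<open>k (m - 2)\<close> into \<open>k (m - 1)\<close>. Within 1/3 of m this transition
            is complete, so both sides of the integer show \<open>k (m - 1)\<close>.\<close>
          then have "\<lfloor>v 0\<rfloor> = m - 1" using v by (intro floor_unique) auto
          moreover have "smooth_step (3 * v 0 + (- 3 * of_int (m - 1) - 1)) = 1" using v by (intro smooth_step_eq_1) simp
          ultimately show ?thesis unfolding h_def Let_def by simp
        qed
      qed
      then show ?thesis using False m by (intro exI[of _ "of_int m - 1 / 3"] exI[of _ "of_int m + 1 / 3"]) auto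
    qed
  qed
  have lift: "\<exists>V. openin (Euclidean_space 1) V \<and> u \<in> V \<and> V \<subseteq> topspace (Euclidean_space 1) \<and>
        D 1 V h \<and> (\<forall>u\<in>V. \<pi> (h u) = \<gamma> u)" if u: "u \<in> topspace (Euclidean_space 1)" for u
  proof -
    obtain c d where "c < u 0" "u 0 < d" "lifts c d h" using cover by blast
    then show ?thesis using u openin_line_interval
      by (intro exI[of _ "line_interval c d"]) (auto simp: lifts_def line_interval_def)
  qed
  then have "locally_on 1 (topspace (Euclidean_space 1)) (\<lambda>V. D 1 V h)"
    unfolding locally_on_def by (intro conjI openin_topspace ballI) blast
  from is_diffeology_local[OF dvs_is_diffeology[OF dvs], OF this]
  have "D 1 (topspace (Euclidean_space 1)) h" .
  moreover have "\<forall>u\<in>topspace (Euclidean_space 1). \<pi> (h u) = \<gamma> u" using lift by blast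
  ultimately show ?thesis by blast
qed

end

section \<open>Linear extension of maps from the basis\<close>

definition free_extension :: "('x \<Rightarrow> 'v::real_vector) \<Rightarrow> ('x \<Rightarrow>\<^sub>0 real) \<Rightarrow> 'v" where
  "free_extension g v = (\<Sum>x\<in>Poly_Mapping.keys v. Poly_Mapping.lookup v x *\<^sub>R g x)"

text \<open>The index set \<open>keys v\<close> changes with the vector; a common finite index set
  is what makes additivity a termwise computation.\<close>

lemma free_extension_superset:
  assumes "finite A" "Poly_Mapping.keys v \<subseteq> A"
  shows "free_extension g v = (\<Sum>x\<in>A. Poly_Mapping.lookup v x *\<^sub>R g x)"
  unfolding free_extension_def using assms
  by (intro sum.mono_neutral_left) (auto simp: in_keys_iff)

lemma linear_free_extension: "linear (free_extension g)"
proof (rule linearI)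
  fix v w :: "'a \<Rightarrow>\<^sub>0 real" and r :: real
  let ?A = "Poly_Mapping.keys v \<union> Poly_Mapping.keys w"
  have "free_extension g (v + w) = (\<Sum>x\<in>?A. Poly_Mapping.lookup (v + w) x *\<^sub>R g x)"
    by (intro free_extension_superset) (simp_all add: keys_add)
  then show "free_extension g (v + w) = free_extension g v + free_extension g w"
    by (simp add: free_extension_superset[of ?A] lookup_add scaleR_add_left sum.distrib)
  have "free_extension g (r *\<^sub>R v) =
      (\<Sum>x\<in>Poly_Mapping.keys v. Poly_Mapping.lookup (r *\<^sub>R v) x *\<^sub>R g x)"
    by (intro free_extension_superset) (auto simp: in_keys_iff lookup_scaleR)
  then show "free_extension g (r *\<^sub>R v) = r *\<^sub>R free_extension g v"
    by (simp add: free_extension_def lookup_scaleR scaleR_sum_right)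
qed

lemma free_extension_single [simp]: "free_extension g (Poly_Mapping.single x 1) = g x"
  by (simp add: free_extension_def)

lemma linear_eq_free_extension:
  assumes "linear f"
  shows "f v = free_extension (\<lambda>x. f (Poly_Mapping.single x 1)) v"
  by (subst poly_mapping_eq_sum_single)
    (simp only: free_extension_def linear_sum[OF assms] linear_scale[OF assms])

lemma free_extension_combination:
  "free_extension g (\<Sum>i\<in>I. r i *\<^sub>R Poly_Mapping.single (x i) 1) = (\<Sum>i\<in>I. r i *\<^sub>R g (x i))"
  by (simp add: linear_sum[OF linear_free_extension] linear_scale[OF linear_free_extension])

text \<open>A plot that is locally a sum of terms r_i [q_i] goes to the sum of r_i g(q_i), which is
  a plot because \<open>D\<close> is a diffeological vector space.\<close>

lemma smooth_map_free_extension: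
  assumes D: "diffeological_vector_space D" and g: "smooth_map X D g"
  shows "smooth_map (free_diffeology X) D (free_extension g)"
  unfolding smooth_map_def
proof (intro allI impI)
  fix n U p assume "free_diffeology X n U p"
  then have "locally_on n U (\<lambda>V. D n V (free_extension g \<circ> p))"
    unfolding free_diffeology_eq
  proof (rule locally_on_mono)
    fix V assume V: "openin (Euclidean_space n) V" and p: "free_combination X n V p"
    obtain k :: nat and r q where *: "\<forall>i<k. smooth_real_on n V (r i)" "\<forall>i<k. X n V (q i)"
      "\<forall>v\<in>V. p v = (\<Sum>i<k. r i v *\<^sub>R Poly_Mapping.single (q i v) 1)"
      by (rule free_combinationE[OF p])
    have "D n V (\<lambda>v. \<Sum>i\<in>{..<k}. r i v *\<^sub>R g (q i v))"
    proof (rule dvs_plot_sum[OF D, OF V])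
      fix i assume i: "i \<in> {..<k}"
      have "D n V (g \<circ> q i)" using smooth_mapD[OF g, of n V "q i"] *(2) i by simp
      then show "D n V (\<lambda>v. r i v *\<^sub>R g (q i v))"
        using dvs_plot_scaleR[OF D, OF _ \<open>D n V (g \<circ> q i)\<close>, of "r i"] *(1) i by simp
    qed
    then show "D n V (free_extension g \<circ> p)"
      by (rule is_diffeology_cong[OF dvs_is_diffeology[OF D]])
        (simp add: *(3) free_extension_combination)
  qed
  then show "D n U (free_extension g \<circ> p)" by (rule is_diffeology_local[OF dvs_is_diffeology[OF D]])
qed

lemma free_diffeology_single:
  assumes X: "is_diffeology X" and q: "X n U q"
  shows "free_diffeology X n U (\<lambda>u. Poly_Mapping.single (q u) 1)"
proof -
  have U: "openin (Euclidean_space n) U" using is_diffeology_openin[OF X, OF q] .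
  have "free_combination X n U (\<lambda>u. Poly_Mapping.single (q u) 1)"
    using q smooth_real_on_const[OF U]
    by (intro free_combinationI[of 1 n U "\<lambda>_ _. 1" X "\<lambda>_. q"]) simp_all
  then show ?thesis unfolding free_diffeology_eq by (intro locally_on_self U)
qed

section \<open>Plots of the wedge and maps out of it\<close>

lemma wedge_line_plot:
  "wedge_diffeology 1 (topspace (Euclidean_space 1)) (\<lambda>u. abs_wedge (s, u 0))"
proof -
  let ?E = "topspace (Euclidean_space 1)"
  have "real_diffeology 1 ?E (\<lambda>u. u 0)"
    by (simp add: real_diffeology_def smooth_real_on_coordinate)
  then have "coprod_diffeology (\<lambda>_. real_diffeology) 1 ?E (\<lambda>u. (s, u 0))"
    unfolding coprod_diffeology_def by (intro locally_on_self openin_topspace) auto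
  then show ?thesis
    unfolding wedge_diffeology_def quotient_diffeology_def
    by (intro locally_on_self openin_topspace) auto
qed

text \<open>The quotient and the coproduct contribute one layer of locality each, and
  \<open>locally_on_idem\<close> merges them. Hence even near the origin a plot can be described on
  a single arm, which is how plots of the wedge are used below.\<close>

lemma wedge_plot_local:
  assumes "wedge_diffeology n U p"
  shows "locally_on n U (\<lambda>V. \<exists>s r. smooth_real_on n V r \<and> (\<forall>v\<in>V. p v = abs_wedge (s, r v)))"
proof (rule locally_on_idem)
  show "locally_on n U (\<lambda>V. locally_on n V
      (\<lambda>V. \<exists>s r. smooth_real_on n V r \<and> (\<forall>v\<in>V. p v = abs_wedge (s, r v))))"
    using assms unfolding wedge_diffeology_def quotient_diffeology_def
  proof (rule locally_on_mono)
    fix V assume "\<exists>q. coprod_diffeology (\<lambda>_. real_diffeology) n V q \<and> (\<forall>v\<in>V. p v = abs_wedge (q v))"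
    then obtain q where q: "coprod_diffeology (\<lambda>_. real_diffeology) n V q" "\<forall>v\<in>V. p v = abs_wedge (q v)"
      by blast
    show "locally_on n V (\<lambda>V. \<exists>s r. smooth_real_on n V r \<and> (\<forall>v\<in>V. p v = abs_wedge (s, r v)))"
      using q(1) unfolding coprod_diffeology_def real_diffeology_def
    proof (rule locally_on_mono)
      fix W assume "W \<subseteq> V" "\<exists>i r. smooth_real_on n W r \<and> (\<forall>v\<in>W. q v = (i, r v))"
      then obtain i r where "smooth_real_on n W r" "\<forall>v\<in>W. q v = (i, r v)" by blast
      then show "\<exists>s r. smooth_real_on n W r \<and> (\<forall>v\<in>W. p v = abs_wedge (s, r v))"
        using q(2) \<open>W \<subseteq> V\<close> by (intro exI[of _ i] exI[of _ r]) auto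
    qed
  qed
qed

text \<open>Where a plot runs on the arm \<open>s\<close> with coordinate \<open>r\<close>, its
  image is the plot \<open>G s\<close> reparametrised by \<open>r\<close>.\<close>

lemma smooth_map_wedge:
  fixes g :: "'i wedge \<Rightarrow> 'v"
  assumes D: "is_diffeology D" and G: "\<And>s. D 1 (topspace (Euclidean_space 1)) (G s)"
    and g: "\<And>s t. g (abs_wedge (s, t)) = G s (line_point t)"
  shows "smooth_map wedge_diffeology D g"
  unfolding smooth_map_def
proof (intro allI impI)
  fix n U and p :: "(nat \<Rightarrow> real) \<Rightarrow> 'i wedge" assume "wedge_diffeology n U p"
  from wedge_plot_local[OF this] have "locally_on n U (\<lambda>V. D n V (g \<circ> p))"
  proof (rule locally_on_mono)
    fix V assume V: "openin (Euclidean_space n) V"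
      and "\<exists>s r. smooth_real_on n V r \<and> (\<forall>v\<in>V. p v = abs_wedge (s, r v))"
    then obtain s r where r: "smooth_real_on n V r" "\<forall>v\<in>V. p v = abs_wedge (s, r v)" by blast
    have "smooth_euclidean n V 1 (topspace (Euclidean_space 1)) (\<lambda>v. line_point (r v))"
      using V r(1) line_point_in_topspace by (auto simp: smooth_euclidean_def)
    from is_diffeology_compose[OF D, OF this G[of s]] show "D n V (g \<circ> p)"
      by (rule is_diffeology_cong[OF D]) (simp add: r(2) g)
  qed
  then show "D n U (g \<circ> p)" by (rule is_diffeology_local[OF D])
qed

lemma abs_wedge_eq_iff: "abs_wedge a = abs_wedge b \<longleftrightarrow> a = b \<or> snd a = 0 \<and> snd b = 0"
  using wedge.abs_eq_iff[of a b] by (simp add: wedge_rel_def)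

text \<open>\<open>rep_wedge\<close> may represent the origin on another arm than the given one; the
  common value \<open>c\<close> at 0 makes this harmless.\<close>

lemma wedge_function_exists:
  fixes h :: "'i \<Rightarrow> real \<Rightarrow> 'v"
  assumes "\<And>s. h s 0 = c"
  shows "\<exists>g. \<forall>s t. g (abs_wedge (s, t)) = h s t"
proof (intro exI allI)
  fix s :: 'i and t
  have "abs_wedge (rep_wedge (abs_wedge (s, t))) = abs_wedge (s, t)"
    by (rule Quotient3_abs_rep[OF Quotient3_wedge])
  then show "(\<lambda>x. case rep_wedge x of (s, t) \<Rightarrow> h s t) (abs_wedge (s, t)) = h s t"
    unfolding abs_wedge_eq_iff using assms by (auto split: prod.splits)
qed

lemma projective_against_free_wedge:
  "projective_against TYPE('v::real_vector) TYPE('w::real_vector)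
    (free_diffeology (wedge_diffeology :: 'i wedge diffeology))"
  unfolding projective_against_def
proof (intro conjI allI impI)
  let ?X = "wedge_diffeology :: 'i wedge diffeology"
  let ?E = "topspace (Euclidean_space 1)"
  show "diffeological_vector_space (free_diffeology ?X)"
    by (rule diffeological_vector_space_free[OF is_diffeology_wedge])
  fix D :: "'v diffeology" and E :: "'w diffeology" and \<pi> f
  assume D: "diffeological_vector_space D" and \<pi>: "linear_subduction D E \<pi>"
    and f: "linear f" "smooth_map (free_diffeology ?X) E f"
  have lin: "linear \<pi>" and E: "E = quotient_diffeology \<pi> D" and surj: "surj \<pi>"
    using \<pi> by (auto simp: linear_subduction_def)
  define F where "F x = f (Poly_Mapping.single x 1)" for x
  have "\<exists>h. D 1 ?E h \<and> (\<forall>u\<in>?E. \<pi> (h u) = F (abs_wedge (s, u 0)))" for s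
  proof -
    have "E 1 ?E (f \<circ> (\<lambda>u. Poly_Mapping.single (abs_wedge (s, u 0)) 1))"
      by (rule smooth_mapD[OF f(2), OF free_diffeology_single[OF is_diffeology_wedge, OF wedge_line_plot]])
    then have "E 1 ?E (\<lambda>u. F (abs_wedge (s, u 0)))" by (simp add: comp_def F_def)
    then have "line_lifting D \<pi> (\<lambda>u. F (abs_wedge (s, u 0)))"
      using D lin by (simp only: line_lifting_def E quotient_diffeology_def simp_thms)
    then show ?thesis by (rule line_lifting.ex_global_lift)
  qed
  then have "\<forall>s. \<exists>h. D 1 ?E h \<and> (\<forall>u\<in>?E. \<pi> (h u) = F (abs_wedge (s, u 0)))" ..
  from choice[OF this] obtain h where
    h: "\<And>s. D 1 ?E (h s)" "\<And>s u. u \<in> ?E \<Longrightarrow> \<pi> (h s u) = F (abs_wedge (s, u 0))"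
    by blast
  obtain c where c: "\<pi> c = F (abs_wedge (undefined, 0))" using surj by (metis surjD)
  have origin: "abs_wedge (s, 0) = abs_wedge (undefined, 0)" for s :: 'i
    by (simp add: abs_wedge_eq_iff)
  \<comment> \<open>Both \<open>c\<close> and \<open>h s (line_point 0)\<close> lift the value at
    the origin, so the added constant is in the kernel of \<pi>: \<open>G s\<close> is still a lift,
    and it takes the value \<open>c\<close> at 0 on every arm.\<close>
  define G where "G s u = h s u + (c - h s (line_point 0))" for s u
  have "D 1 ?E (G s)" for s
    unfolding G_def
    by (rule dvs_plot_add[OF D, OF h(1) is_diffeology_const[OF dvs_is_diffeology[OF D], OF openin_topspace]])
  moreover have \<pi>G: "\<pi> (G s (line_point t)) = F (abs_wedge (s, t))" for s t
    using h(2)[OF line_point_in_topspace] c origin[of s]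
    by (simp add: G_def linear_add[OF lin] linear_diff[OF lin])
  moreover obtain g where g: "\<And>s t. g (abs_wedge (s, t)) = G s (line_point t)"
    using wedge_function_exists[of "\<lambda>s t. G s (line_point t)" c] by (auto simp: G_def)
  ultimately have "smooth_map ?X D g" using smooth_map_wedge[OF dvs_is_diffeology[OF D]] by blast
  moreover have "\<pi> (g x) = F x" for x
  proof -
    obtain s t where "x = abs_wedge (s, t)" using surj_abs_wedge by (metis surj_pair surjD)
    then show ?thesis by (simp add: g \<pi>G)
  qed
  then have "\<pi> (free_extension g v) = f v" for v
    unfolding linear_eq_free_extension[OF f(1), of v]
    by (simp add: free_extension_def F_def linear_sum[OF lin] linear_scale[OF lin])
  ultimately show "\<exists>g. linear g \<and> smooth_map (free_diffeology ?X) D g \<and> \<pi> \<circ> g = f"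
    using linear_free_extension smooth_map_free_extension[OF D]
    by (intro exI[of _ "free_extension g"]) auto
qed

section \<open>The D-topology\<close>

text \<open>\<open>topology\<close> returns the given family of sets only if it is a topology, which
  holds because preimages commute with unions and intersections.\<close>

lemma openin_D_topology:
  "openin (D_topology D) A \<longleftrightarrow>
    (\<forall>n U p. D n U p \<longrightarrow> openin (Euclidean_space n) {u \<in> U. p u \<in> A})"
proof -
  have "istopology (\<lambda>A. \<forall>n U p. D n U p \<longrightarrow> openin (Euclidean_space n) {u \<in> U. p u \<in> A})"
    unfolding istopology_def
  proof (intro conjI allI impI)
    fix S T n U p
    assume S: "\<forall>n U p. D n U p \<longrightarrow> openin (Euclidean_space n) {u \<in> U. p u \<in> S}"
      and T: "\<forall>n U p. D n U p \<longrightarrow> openin (Euclidean_space n) {u \<in> U. p u \<in> T}" and p: "D n U p"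
    have "{u \<in> U. p u \<in> S \<inter> T} = {u \<in> U. p u \<in> S} \<inter> {u \<in> U. p u \<in> T}" by auto
    moreover have "openin (Euclidean_space n) ({u \<in> U. p u \<in> S} \<inter> {u \<in> U. p u \<in> T})"
      using S T p by (intro openin_Int) simp_all
    ultimately show "openin (Euclidean_space n) {u \<in> U. p u \<in> S \<inter> T}" by simp
  next
    fix K n U p
    assume K: "\<forall>S\<in>K. \<forall>n U p. D n U p \<longrightarrow> openin (Euclidean_space n) {u \<in> U. p u \<in> S}"
      and p: "D n U p"
    have "{u \<in> U. p u \<in> \<Union>K} = (\<Union>S\<in>K. {u \<in> U. p u \<in> S})" by auto
    moreover have "openin (Euclidean_space n) (\<Union>S\<in>K. {u \<in> U. p u \<in> S})"
      using K p by (intro openin_Union) auto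
    ultimately show "openin (Euclidean_space n) {u \<in> U. p u \<in> \<Union>K}" by simp
  qed
  then show ?thesis by (simp add: D_topology_def topology_inverse')
qed

section \<open>Separation of vectors by functionals continuous along plots\<close>

lemma continuous_on_local:
  assumes "locally_on n U (\<lambda>V. continuous_on V h)"
  shows "continuous_on U (h :: _ \<Rightarrow> real)"
proof -
  have U: "openin (Euclidean_space n) U" using assms by (simp add: locally_on_def)
  have "C_k_on 0 n U h"
  proof (rule C_k_on_local[OF U])
    fix x assume "x \<in> U"
    then obtain V where V: "openin (Euclidean_space n) V" "x \<in> V" "V \<subseteq> U" "continuous_on V h"
      using assms unfolding locally_on_def by blast
    then show "\<exists>V. openin (Euclidean_space n) V \<and> x \<in> V \<and> V \<subseteq> U \<and> C_k_on 0 n V h"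
      by (intro exI[of _ V]) (simp add: C_k_on_0_iff)
  qed
  then show ?thesis by (simp add: C_k_on_0_iff[OF U])
qed

lemma locally_on_all_less:
  fixes k :: nat
  assumes "openin (Euclidean_space n) U" "\<And>i. i < k \<Longrightarrow> locally_on n U (P i)"
    and P: "\<And>i V W. P i V \<Longrightarrow> openin (Euclidean_space n) W \<Longrightarrow> W \<subseteq> V \<Longrightarrow> P i W"
  shows "locally_on n U (\<lambda>V. \<forall>i<k. P i V)"
  using assms(2)
proof (induction k)
  case 0
  then show ?case using assms(1) by (simp add: locally_on_self)
next
  case (Suc k)
  have "locally_on n U (\<lambda>V. (\<forall>i<k. P i V) \<and> P k V)"
    by (rule locally_on_conj) (use Suc P in auto)
  then show ?case by (rule locally_on_mono) (auto simp: less_Suc_eq)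
qed

text \<open>Along a sum of terms r_i [q_i] the extension is the sum of r_i \<phi>(q_i). Thus every
  function on the base that is continuous along plots yields a linear functional with the same
  property.\<close>

lemma continuous_on_free_extension_plot:
  assumes \<phi>: "\<And>U q. X n U q \<Longrightarrow> continuous_on U (\<lambda>u. \<phi> (q u))"
    and p: "free_diffeology X n U p"
  shows "continuous_on U (\<lambda>u. free_extension \<phi> (p u) :: real)"
proof (rule continuous_on_local)
  show "locally_on n U (\<lambda>V. continuous_on V (\<lambda>u. free_extension \<phi> (p u)))"
    using p unfolding free_diffeology_eq
  proof (rule locally_on_mono)
    fix V assume "free_combination X n V p"
    then obtain k :: nat and r q where *: "\<forall>i<k. smooth_real_on n V (r i)" "\<forall>i<k. X n V (q i)"
      "\<forall>v\<in>V. p v = (\<Sum>i<k. r i v *\<^sub>R Poly_Mapping.single (q i v) 1)"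
      by (rule free_combinationE)
    have "continuous_on V (\<lambda>v. \<Sum>i<k. r i v * \<phi> (q i v))"
    proof (rule continuous_on_sum, rule continuous_on_mult)
      fix i assume i: "i \<in> {..<k}"
      show "continuous_on V (r i)" using *(1) i by (intro smooth_real_on_continuous[of n]) simp
      show "continuous_on V (\<lambda>v. \<phi> (q i v))" using *(2) i by (intro \<phi>) simp
    qed
    then show "continuous_on V (\<lambda>u. free_extension \<phi> (p u))"
      by (rule continuous_on_cong[THEN iffD1, rotated 2])
        (simp_all add: *(3) free_extension_combination)
  qed
qed

text \<open>\<phi> is a tent of height 1 around \<open>x\<close>, with radius the least distance
  from \<open>x\<close> to \<open>K\<close>. Continuity suffices, as only the D-topology is at
  stake.\<close>

lemma wedge_separation:
  fixes x :: "'i wedge"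
  assumes "finite K" "x \<notin> K"
  obtains \<phi> :: "'i wedge \<Rightarrow> real" where "\<phi> x = 1" "\<forall>y\<in>K. \<phi> y = 0"
    "\<forall>n U q. wedge_diffeology n U q \<longrightarrow> continuous_on U (\<lambda>u. \<phi> (q u))"
proof -
  obtain s t where x: "x = abs_wedge (s, t)" using surj_abs_wedge by (metis surj_pair surjD)
  \<comment> \<open>The path distance from \<open>x\<close>: straight along its own arm, through the
    origin to any other. At the origin both formulas give the absolute value of
    \<open>t\<close>.\<close>
  have "\<exists>\<rho>. \<forall>s' t'. \<rho> (abs_wedge (s', t')) = (if s' = s then \<bar>t' - t\<bar> else \<bar>t'\<bar> + \<bar>t\<bar>)"
    by (rule wedge_function_exists[of _ "\<bar>t\<bar>"]) simp
  then obtain \<rho> :: "'i wedge \<Rightarrow> real" where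
    \<rho>: "\<And>s' t'. \<rho> (abs_wedge (s', t')) = (if s' = s then \<bar>t' - t\<bar> else \<bar>t'\<bar> + \<bar>t\<bar>)"
    by blast
  have pos: "\<rho> y > 0" if "y \<noteq> x" for y
  proof -
    obtain s' t' where "y = abs_wedge (s', t')" using surj_abs_wedge by (metis surj_pair surjD)
    with that show ?thesis by (auto simp: \<rho> x abs_wedge_eq_iff)
  qed
  \<comment> \<open>The extra element 1 covers the case of empty \<open>K\<close>.\<close>
  define d where "d = Min (insert 1 (\<rho> ` K))"
  have d: "d > 0" "\<And>y. y \<in> K \<Longrightarrow> d \<le> \<rho> y"
  proof -
    have "\<rho> y > 0" if "y \<in> K" for y using assms(2) that by (intro pos) auto
    then show "d > 0" using assms(1) by (simp add: d_def)
    show "d \<le> \<rho> y" if "y \<in> K" for y using assms(1) that by (auto simp: d_def)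
  qed
  define \<phi> where "\<phi> y = max 0 (1 - \<rho> y / d)" for y
  have "continuous_on U (\<lambda>u. \<phi> (q u))" if "wedge_diffeology n U q" for n U q
  proof (rule continuous_on_local)
    show "locally_on n U (\<lambda>V. continuous_on V (\<lambda>u. \<phi> (q u)))"
      using wedge_plot_local[OF that]
    proof (rule locally_on_mono)
      fix V assume "\<exists>s r. smooth_real_on n V r \<and> (\<forall>v\<in>V. q v = abs_wedge (s, r v))"
      then obtain s' r where r: "smooth_real_on n V r" "\<forall>v\<in>V. q v = abs_wedge (s', r v)" by blast
      have "continuous_on V (\<lambda>v. if s' = s then \<bar>r v - t\<bar> else \<bar>r v\<bar> + \<bar>t\<bar>)"
        using smooth_real_on_continuous[OF r(1)] by (cases "s' = s") (auto intro!: continuous_intros)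
      then have "continuous_on V (\<lambda>v. max 0 (1 - (if s' = s then \<bar>r v - t\<bar> else \<bar>r v\<bar> + \<bar>t\<bar>) / d))"
        using d(1) by (intro continuous_on_max continuous_on_diff continuous_on_divide continuous_on_const) auto
      then show "continuous_on V (\<lambda>u. \<phi> (q u))"
        by (rule continuous_on_cong[THEN iffD1, rotated 2]) (simp_all add: r(2) \<phi>_def \<rho>)
    qed
  qed
  moreover have "\<phi> x = 1" by (simp add: \<phi>_def x \<rho>)
  moreover have "\<forall>y\<in>K. \<phi> y = 0" using d by (simp add: \<phi>_def)
  ultimately show ?thesis using that by blast
qed

text \<open>If \<open>p u\<close> and \<open>w\<close> differ in the coefficient of
  \<open>x\<close>, a function that is 1 at \<open>x\<close> and 0 on the rest of both supports
  extends to a functional reading off this coefficient. It separates \<open>p u\<close> from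
  \<open>w\<close>, and by continuity it keeps doing so near \<open>u\<close>.\<close>

lemma free_wedge_plot_neq_open:
  assumes p: "free_diffeology wedge_diffeology n U p"
  shows "openin (Euclidean_space n) {u \<in> U. p u \<noteq> w}"
proof (subst openin_subopen, intro ballI)
  fix u assume u: "u \<in> {u \<in> U. p u \<noteq> w}"
  then obtain x where x: "Poly_Mapping.lookup (p u) x \<noteq> Poly_Mapping.lookup w x"
    using poly_mapping_eqI[of "p u" w] by auto
  let ?K = "Poly_Mapping.keys (p u) \<union> Poly_Mapping.keys w"
  have "finite (?K - {x})" "x \<notin> ?K - {x}" by simp_all
  then obtain \<phi> :: "'a wedge \<Rightarrow> real" where \<phi>: "\<phi> x = 1" "\<forall>y\<in>?K - {x}. \<phi> y = 0"
    "\<forall>n U q. wedge_diffeology n U q \<longrightarrow> continuous_on U (\<lambda>u. \<phi> (q u))"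
    by (rule wedge_separation)
  \<comment> \<open>The extension reads the coefficient of \<open>x\<close> only for vectors
    supported in \<open>?K\<close>. Other values of the plot may have points elsewhere, but for them
    continuity is all that is used.\<close>
  have ext: "free_extension \<phi> v = Poly_Mapping.lookup v x" if "Poly_Mapping.keys v \<subseteq> ?K" for v
  proof -
    have "free_extension \<phi> v = (\<Sum>y\<in>insert x ?K. Poly_Mapping.lookup v y *\<^sub>R \<phi> y)"
      using that by (intro free_extension_superset) auto
    also have "\<dots> = (\<Sum>y\<in>insert x ?K. if y = x then Poly_Mapping.lookup v x else 0)"
      using \<phi>(1,2) by (intro sum.cong) auto
    also have "\<dots> = Poly_Mapping.lookup v x" by (simp add: sum.delta)
    finally show ?thesis .
  qed
  have cont: "continuous_on U (\<lambda>u. free_extension \<phi> (p u))"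
    by (rule continuous_on_free_extension_plot[OF _ p]) (use \<phi>(3) in blast)
  have U: "openin (Euclidean_space n) U"
    using is_diffeology_openin[OF is_diffeology_free[OF is_diffeology_wedge], OF p] .
  have "openin (top_of_set U) (U \<inter> (\<lambda>u. free_extension \<phi> (p u)) -` (- {free_extension \<phi> w}))"
    using cont by (rule continuous_openin_preimage_gen) auto
  then have "openin (Euclidean_space n) (U \<inter> (\<lambda>u. free_extension \<phi> (p u)) -` (- {free_extension \<phi> w}))"
    using U unfolding Euclidean_space_eq_top_of_set by (rule openin_trans)
  moreover have "free_extension \<phi> (p u) \<noteq> free_extension \<phi> w" using x by (simp add: ext)
  ultimately show "\<exists>T. openin (Euclidean_space n) T \<and> u \<in> T \<and> T \<subseteq> {u \<in> U. p u \<noteq> w}"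
    using u by (intro exI[of _ "U \<inter> (\<lambda>u. free_extension \<phi> (p u)) -` (- {free_extension \<phi> w})"]) auto
qed

lemma free_wedge_plot_notin_finite_open:
  assumes "finite F" and p: "free_diffeology wedge_diffeology n U p"
  shows "openin (Euclidean_space n) {u \<in> U. p u \<notin> F}"
  using assms(1)
proof (induction F)
  case empty
  then show ?case
    using is_diffeology_openin[OF is_diffeology_free[OF is_diffeology_wedge], OF p] by simp
next
  case (insert w F)
  have "{u \<in> U. p u \<notin> insert w F} = {u \<in> U. p u \<noteq> w} \<inter> {u \<in> U. p u \<notin> F}" by auto
  then show ?case using openin_Int[OF free_wedge_plot_neq_open[OF p] insert.IH] by simp
qed

text \<open>A local expression has finitely many terms, and after shrinking each \<open>q i\<close>
  stays on one arm. The set \<open>T\<close> serves all \<open>v\<close> at once, although the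
  points of the supports may move along these arms.\<close>

lemma free_wedge_plot_finite_arms:
  assumes "free_diffeology wedge_diffeology n U p"
  shows "locally_on n U (\<lambda>V. \<exists>T. finite T \<and>
    (\<forall>v\<in>V. Poly_Mapping.keys (p v) \<subseteq> {abs_wedge (s, t) | s t. s \<in> T}))"
proof (rule locally_on_idem)
  let ?P = "\<lambda>V. \<exists>T. finite T \<and> (\<forall>v\<in>V. Poly_Mapping.keys (p v) \<subseteq> {abs_wedge (s, t) | s t. s \<in> T})"
  show "locally_on n U (\<lambda>V. locally_on n V ?P)"
    using assms unfolding free_diffeology_eq
  proof (rule locally_on_mono)
    fix V assume V: "openin (Euclidean_space n) V" and p: "free_combination wedge_diffeology n V p"
    obtain k :: nat and r q where "\<forall>i<k. smooth_real_on n V (r i)"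
      and *: "\<forall>i<k. wedge_diffeology n V (q i)"
        "\<forall>v\<in>V. p v = (\<Sum>i<k. r i v *\<^sub>R Poly_Mapping.single (q i v) 1)"
      by (rule free_combinationE[OF p])
    have "locally_on n V (\<lambda>W. \<forall>i<k. \<exists>s. \<forall>v\<in>W. \<exists>t. q i v = abs_wedge (s, t))"
    proof (rule locally_on_all_less[OF V])
      fix i assume "i < k"
      then have "wedge_diffeology n V (q i)" using *(1) by simp
      from wedge_plot_local[OF this] show "locally_on n V (\<lambda>W. \<exists>s. \<forall>v\<in>W. \<exists>t. q i v = abs_wedge (s, t))"
        by (rule locally_on_mono) blast
    qed blast
    then show "locally_on n V ?P"
    proof (rule locally_on_mono)
      fix W assume W: "W \<subseteq> V" "\<forall>i<k. \<exists>s. \<forall>v\<in>W. \<exists>t. q i v = abs_wedge (s, t)"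
      then have "\<forall>i\<in>{..<k}. \<exists>s. \<forall>v\<in>W. \<exists>t. q i v = abs_wedge (s, t)" by simp
      from bchoice[OF this] obtain s where
        s: "\<forall>i\<in>{..<k}. \<forall>v\<in>W. \<exists>t. q i v = abs_wedge (s i, t)" ..
      have "Poly_Mapping.keys (p v) \<subseteq> {abs_wedge (a, t) | a t. a \<in> s ` {..<k}}" if v: "v \<in> W" for v
      proof -
        have "p v = (\<Sum>i<k. r i v *\<^sub>R Poly_Mapping.single (q i v) 1)"
          using *(2) v W(1) by blast
        then have "Poly_Mapping.keys (p v) \<subseteq>
            (\<Union>i<k. Poly_Mapping.keys (r i v *\<^sub>R Poly_Mapping.single (q i v) (1 :: real)))"
          by (simp only: keys_sum)
        also have "\<dots> \<subseteq> (\<Union>i<k. {q i v})"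
          by (auto simp: in_keys_iff lookup_scaleR lookup_single when_def split: if_splits)
        also have "\<dots> \<subseteq> {abs_wedge (a, t) | a t. a \<in> s ` {..<k}}"
          using s v by fastforce
        finally show ?thesis .
      qed
      then show "?P W" by (intro exI[of _ "s ` {..<k}"]) simp
    qed
  qed
qed

text \<open>By \<open>abs_wedge_eq_iff\<close>, all the \<open>abs_wedge (s, 0)\<close> are the same point; \<open>undefined\<close> is an arbitrary arm.\<close>

definition wedge_vector :: "'i \<Rightarrow> real \<Rightarrow> 'i wedge \<Rightarrow>\<^sub>0 real" where
  "wedge_vector s t = Poly_Mapping.single (abs_wedge (s, t)) 1 - Poly_Mapping.single (abs_wedge (undefined, 0)) 1"

lemma wedge_vector_0 [simp]: "wedge_vector s 0 = 0"
proof -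
  have "abs_wedge (s, 0) = abs_wedge (undefined, 0)" by (simp add: abs_wedge_eq_iff)
  then show ?thesis by (simp add: wedge_vector_def)
qed

text \<open>Away from the origin the subtracted basis vector is invisible and the wedge identifies
  nothing, so arm and parameter can be read off.\<close>

lemma lookup_wedge_vector:
  assumes "t' \<noteq> 0"
  shows "Poly_Mapping.lookup (wedge_vector s t) (abs_wedge (s', t')) = (if s = s' \<and> t = t' then 1 else 0)"
  using assms by (auto simp: wedge_vector_def lookup_minus lookup_single when_def abs_wedge_eq_iff)

text \<open>For a fixed arm \<open>s\<close> the vectors \<open>wedge_vector s t\<close> form a plot
  passing through 0 at t = 0. The radius depends on \<open>s\<close>, and this lack of uniformity is
  what the diagonal argument exploits.\<close>

lemma wedge_vector_in_nhd:
  assumes B: "openin (D_topology (free_diffeology wedge_diffeology)) B" "0 \<in> B"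
  shows "\<exists>d>0. \<forall>t. \<bar>t\<bar> < d \<longrightarrow> wedge_vector s t \<in> B"
proof -
  let ?E = "topspace (Euclidean_space 1)"
  have V: "diffeological_vector_space (free_diffeology (wedge_diffeology :: 'a wedge diffeology))"
    by (rule diffeological_vector_space_free[OF is_diffeology_wedge])
  have "free_diffeology wedge_diffeology 1 ?E (\<lambda>u. Poly_Mapping.single (abs_wedge (s, u 0)) 1 +
      (- Poly_Mapping.single (abs_wedge (undefined, 0)) 1))"
    by (rule dvs_plot_add[OF V, OF free_diffeology_single[OF is_diffeology_wedge, OF wedge_line_plot]
        is_diffeology_const[OF dvs_is_diffeology[OF V], OF openin_topspace]])
  then have "free_diffeology wedge_diffeology 1 ?E (\<lambda>u. wedge_vector s (u 0))"
    by (simp add: wedge_vector_def)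
  then have "openin (Euclidean_space 1) {u \<in> ?E. wedge_vector s (u 0) \<in> B}"
    using B(1) unfolding openin_D_topology by blast
  moreover have "line_point 0 \<in> {u \<in> ?E. wedge_vector s (u 0) \<in> B}"
    using B(2) line_point_in_topspace by simp
  ultimately obtain d where d: "d > 0"
    "line_interval (line_point 0 0 - d) (line_point 0 0 + d) \<subseteq> {u \<in> ?E. wedge_vector s (u 0) \<in> B}"
    by (rule line_interval_neighbourhood)
  have "wedge_vector s t \<in> B" if "\<bar>t\<bar> < d" for t
  proof -
    have "line_point t \<in> line_interval (line_point 0 0 - d) (line_point 0 0 + d)"
      using that line_point_in_topspace by (auto simp: line_interval_def)
    then show ?thesis using d(2) by auto
  qed
  then show ?thesis using d(1) by blast
qed

section \<open>The closed set of diagonal vectors\<close>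

definition const_seq :: "nat \<Rightarrow> pos_seq" where
  "const_seq n = Abs_pos_seq (\<lambda>_. Suc n)"

text \<open>Constant sequences serve as labels of distinct arms: a finite set of arms contains only
  finitely many of them, which bounds the index \<open>n\<close> of a diagonal vector.\<close>

lemma inj_const_seq: "inj const_seq"
  by (rule injI) (simp add: const_seq_def Abs_pos_seq_inject fun_eq_iff)

text \<open>Each label controls the size on the other arm: the entry \<open>s n\<close> makes the
  summand on the arm of \<open>n\<close> small, and a large \<open>n\<close> makes the summand on
  the arm \<open>s\<close> small.\<close>

definition diagonal_vector :: "pos_seq \<Rightarrow> nat \<Rightarrow> pos_seq wedge \<Rightarrow>\<^sub>0 real" where
  "diagonal_vector s n = wedge_vector (const_seq n) (inverse (real (Rep_pos_seq s n))) +
     wedge_vector s (inverse (real (Suc n)))"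

text \<open>Away from the origin all coefficients are nonnegative, so nothing cancels. If
  \<open>s\<close> is \<open>const_seq n\<close>, both points coincide and the coefficient is
  2.\<close>

lemma diagonal_vector_keys:
  "abs_wedge (const_seq n, inverse (real (Rep_pos_seq s n))) \<in> Poly_Mapping.keys (diagonal_vector s n)"
  "abs_wedge (s, inverse (real (Suc n))) \<in> Poly_Mapping.keys (diagonal_vector s n)"
proof -
  have "Rep_pos_seq s n > 0" using Rep_pos_seq[of s] by simp
  then show "abs_wedge (const_seq n, inverse (real (Rep_pos_seq s n))) \<in> Poly_Mapping.keys (diagonal_vector s n)"
    by (simp add: diagonal_vector_def in_keys_iff lookup_add lookup_wedge_vector)
  show "abs_wedge (s, inverse (real (Suc n))) \<in> Poly_Mapping.keys (diagonal_vector s n)"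
    unfolding diagonal_vector_def in_keys_iff lookup_add by (subst (1 2) lookup_wedge_vector) auto
qed

lemma openin_Compl_diagonal_vectors:
  "openin (D_topology (free_diffeology wedge_diffeology)) (- range (case_prod diagonal_vector))"
  unfolding openin_D_topology
proof (intro allI impI)
  fix n U and p :: "(nat \<Rightarrow> real) \<Rightarrow> pos_seq wedge \<Rightarrow>\<^sub>0 real"
  assume p: "free_diffeology wedge_diffeology n U p"
  let ?C = "range (case_prod diagonal_vector)"
  show "openin (Euclidean_space n) {u \<in> U. p u \<in> - ?C}"
  proof (subst openin_subopen, intro ballI)
    fix u assume u: "u \<in> {u \<in> U. p u \<in> - ?C}"
    then obtain V T where V: "openin (Euclidean_space n) V" "u \<in> V" "V \<subseteq> U" and "finite T"
      and T: "\<forall>v\<in>V. Poly_Mapping.keys (p v) \<subseteq> {abs_wedge (s, t) | s t. s \<in> T}"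
      using free_wedge_plot_finite_arms[OF p] unfolding locally_on_def by blast
    \<comment> \<open>All diagonal vectors both of whose arms lie in \<open>T\<close>. Injectivity
      of \<open>const_seq\<close> leaves finitely many second indices.\<close>
    define F where "F = case_prod diagonal_vector ` (T \<times> const_seq -` T)"
    have "finite F"
      unfolding F_def using \<open>finite T\<close> finite_vimageI[OF \<open>finite T\<close> inj_const_seq] by simp
    have "p v \<in> F" if v: "v \<in> V" "p v \<in> ?C" for v
    proof -
      obtain s m where sm: "p v = diagonal_vector s m" using v(2) by auto
      \<comment> \<open>The origin belongs to every arm, so only a key away from it identifies its
        arm.\<close>
      have arm: "a \<in> T" if "abs_wedge (a, b) \<in> Poly_Mapping.keys (p v)" "b \<noteq> 0" for a b
        using that T v(1) by (fastforce simp: abs_wedge_eq_iff)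
      have "Rep_pos_seq s m > 0" using Rep_pos_seq[of s] by simp
      then have "const_seq m \<in> T" "s \<in> T"
        using arm diagonal_vector_keys[where s = s and n = m] unfolding sm by simp_all
      then show ?thesis unfolding F_def sm by force
    qed
    moreover have "F \<subseteq> ?C" by (auto simp: F_def)
    ultimately have "{v \<in> V. p v \<notin> F} \<subseteq> {u \<in> U. p u \<in> - ?C}" "u \<in> {v \<in> V. p v \<notin> F}"
      using V u by blast+
    moreover have "free_diffeology wedge_diffeology n V p"
      by (rule is_diffeology_subset[OF is_diffeology_free[OF is_diffeology_wedge], OF p V(1,3)])
    then have "openin (Euclidean_space n) {v \<in> V. p v \<notin> F}"
      by (rule free_wedge_plot_notin_finite_open[OF \<open>finite F\<close>])
    ultimately show "\<exists>T. openin (Euclidean_space n) T \<and> u \<in> T \<and> T \<subseteq> {u \<in> U. p u \<in> - ?C}" by blast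
  qed
qed

lemma not_topological_vector_space_free_wedge:
  "\<not> topological_vector_space (D_topology (free_diffeology (wedge_diffeology :: pos_seq wedge diffeology)))"
proof
  let ?T = "D_topology (free_diffeology (wedge_diffeology :: pos_seq wedge diffeology))"
  let ?C = "range (case_prod diagonal_vector)"
  assume "topological_vector_space ?T"
  then have top: "topspace ?T = UNIV"
    and "continuous_map (prod_topology ?T ?T) ?T (\<lambda>(x, y). x + y)"
    by (simp_all add: topological_vector_space_def)
  from openin_continuous_map_preimage[OF this(2) openin_Compl_diagonal_vectors]
  have sum_open: "openin (prod_topology ?T ?T) {z. fst z + snd z \<notin> ?C}"
    by (simp add: top case_prod_unfold)
  have "diagonal_vector s n \<noteq> 0" for s n
    using diagonal_vector_keys(2)[of s n] by (auto simp: in_keys_iff)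
  then have "0 \<notin> ?C" by (auto simp: image_iff)
  then have "(0, 0) \<in> {z. fst z + snd z \<notin> ?C}" by simp
  from openin_prod_topology_alt[THEN iffD1, rule_format, OF sum_open this]
  obtain B B' where B: "openin ?T B" "openin ?T B'" "0 \<in> B" "0 \<in> B'"
    "B \<times> B' \<subseteq> {z. fst z + snd z \<notin> ?C}"
    by (elim exE conjE) (rule that)
  \<comment> \<open>The radius of \<open>B\<close> may shrink arbitrarily from arm to arm, hence one
    integer for each \<open>n\<close>. The sequence of these integers will itself be the index of an
    arm.\<close>
  have "\<exists>N>0. wedge_vector (const_seq n) (inverse (real N)) \<in> B" for n
  proof -
    obtain d where d: "d > 0" "\<forall>t. \<bar>t\<bar> < d \<longrightarrow> wedge_vector (const_seq n) t \<in> B"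
      using wedge_vector_in_nhd[OF B(1,3)] by blast
    obtain N where "N > 0" "inverse (real N) < d" using ex_inverse_of_nat_less[OF d(1)] by blast
    then show ?thesis using d(2) by (intro exI[of _ N]) simp
  qed
  then have "\<forall>n. \<exists>N>0. wedge_vector (const_seq n) (inverse (real N)) \<in> B" by blast
  from choice[OF this] obtain f where
    f: "\<And>n. f n > 0" "\<And>n. wedge_vector (const_seq n) (inverse (real (f n))) \<in> B" by blast
  define s where "s = Abs_pos_seq f"
  have s: "Rep_pos_seq s = f" using f(1) by (simp add: s_def Abs_pos_seq_inverse)
  \<comment> \<open>The order matters: \<open>B'\<close> is examined along the arm \<open>s\<close>
    that was built from \<open>B\<close>. Since the summands on the arms \<open>const_seq n\<close>
    lie in \<open>B\<close> for all \<open>n\<close>, the index can now be chosen for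
    \<open>B'\<close> alone.\<close>
  obtain d where d: "d > 0" "\<forall>t. \<bar>t\<bar> < d \<longrightarrow> wedge_vector s t \<in> B'"
    using wedge_vector_in_nhd[OF B(2,4)] by blast
  obtain n where "inverse (real (Suc n)) < d" using reals_Archimedean[OF d(1)] by blast
  then have "wedge_vector s (inverse (real (Suc n))) \<in> B'" using d(2) by simp
  then have "(wedge_vector (const_seq n) (inverse (real (f n))), wedge_vector s (inverse (real (Suc n)))) \<in>
      B \<times> B'"
    using f(2)[of n] by blast
  from subsetD[OF B(5) this] have "diagonal_vector s n \<notin> ?C"
    by (simp only: mem_Collect_eq fst_conv snd_conv diagonal_vector_def s not_False_eq_True)
  moreover have "diagonal_vector s n = case_prod diagonal_vector (s, n)" by simp
  ultimately show False by blast
qed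

theorem theorem9p9:
  fixes X :: "pos_seq wedge diffeology"
    and V :: "(pos_seq wedge \<Rightarrow>\<^sub>0 real) diffeology"
  assumes "X = wedge_diffeology"
    and "V = free_diffeology X"
  shows "diffeological_vector_space V \<and>
    projective_against TYPE('v::real_vector) TYPE('w::real_vector) V \<and>
    \<not> topological_vector_space (D_topology V)"
  unfolding assms
  using diffeological_vector_space_free[OF is_diffeology_wedge] projective_against_free_wedge
    not_topological_vector_space_free_wedge by blast

end
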